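(* Let $\varepsilon>0$, $u_0\in\mathcal V_{[0,1]}\setminus\{\mathbf 0,\mathbf 1\}$, and $\tau_n\downarrow0$. For each $\tau\in(0,\varepsilon)$ let $(u^{[\tau]}_m)_{m\ge0}$, $(\beta^{[\tau]}_m)_{m\ge1}$ be any semi-discrete iterates with time step $\tau$ and initial state $u^{[\tau]}_0=u_0$. Then there exist a subsequence $\tau'_n$ of $\tau_n$ with $\tau'_n<\varepsilon$ for all $n$, and a solution $(\hat u,\gamma)$ of mass-conserving double-obstacle AC flow on $[0,\infty)$ with $\hat u(0)=u_0$, such that: (1) $t\mapsto\beta^{[\tau'_n]}_{\lceil t/\tau'_n\rceil}$ converges to $\gamma$ weakly in $L^2_{loc}([0,\infty);\mathcal V)$ and weakly-* in $L^\infty_{loc}([0,\infty);\mathcal V)$; (2) for each $t\ge0$, with $m:=\lceil t/\tau'_n\rceil$, $u^{[\tau'_n]}_m\to\hat u(t)$ as $n\to\infty$; (3) there is a sequence $N_k\to\infty$ such that for almost every $t\ge0$, with $m:=\lceil t/\tau'_n\rceil$, $\frac1{N_k}\sum_{n=1}^{N_k}\beta^{[\tau'_n]}_m\to\gamma(t)$ as $k\to\infty$.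
   Context: $G=(V,E)$ is a finite, simple, connected, undirected graph with weights $\omega_{ij}=\omega_{ji}>0$ for $ij\in E$, $\omega_{ij}=0$ otherwise; $d_i=\sum_j\omega_{ij}$, $r\in[0,1]$ fixed. $\mathcal V$ = functions $V\to\mathbb R$ with $\langle u,v\rangle_{\mathcal V}=\sum_i u_iv_id_i^r$; $\mathcal V_{[0,1]}$ = functions $V\to[0,1]$. $(\Delta u)_i=d_i^{-r}\sum_j\omega_{ij}(u_i-u_j)$, $e^{-\tau\Delta}$ its matrix exponential. $\mathbf 1$ all-ones, $\mathbf 0$ zero function; $\mathcal M(u)=\langle u,\mathbf 1\rangle_{\mathcal V}$; $\bar v=\mathcal M(v)/\mathcal M(\mathbf 1)$. For $u\in\mathcal V_{[0,1]}$, $\mathcal B(u)$ = set of $\beta\in\mathcal V$ with $\beta_i\ge0$ if $u_i=0$, $\beta_i=0$ if $0<u_i<1$, $\beta_i\le0$ if $u_i=1$; $\mathcal B(u)=\emptyset$ otherwise. Semi-discrete iterates with time step $\tau$ and $\lambda=\tau/\varepsilon$: sequences with $\beta^{[\tau]}_{m+1}\in\mathcal B(u^{[\tau]}_{m+1})$ and $u^{[\tau]}_{m+1} -e^{-\tau\Delta}u^{[\tau]}_m-\lambda u^{[\tau]}_{m+1}+\lambda\overline{u^{[\tau]}_{m+1}}\mathbf{1} =\lambda\beta^{[\tau]}_{m+1} -\lambda\overline{\beta^{[\tau]}_{m+1}}\mathbf{1}$ for all $m\ge0$. $H^1_{loc}(T;\mathcal V)$: functions $T\to\mathcal V$ whose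 components lie in $H^1((a,b))$ for all $a,b\in T$, with weak derivative $du/dt$. A pair $(u,\beta)$ is a solution to mass-conserving double-obstacle AC flow on $T$ if $u\in H^1_{loc}(T;\mathcal V)\cap C^0(T;\mathcal V)$, $u(t)\in\mathcal V_{[0,1]}$ for all $t$, and for a.e. $t\in T$: $\varepsilon \frac{du}{dt} + \varepsilon\Delta u(t)-u(t)+\overline{u(t)}\mathbf{1} = \beta(t) - \overline{\beta(t)}\mathbf{1}$ and $\beta(t)\in\mathcal B(u(t))$. *)

theory Defs
  imports "HOL-Analysis.Analysis"
begin

section \<open>Weighted graph\<close>

definition weighted_graph :: "('v::finite \<Rightarrow> 'v \<Rightarrow> real) \<Rightarrow> bool" where
  "weighted_graph \<omega> \<longleftrightarrow>
     (\<forall>i j. \<omega> i j = \<omega> j i) \<and> (\<forall>i j. 0 \<le> \<omega> i j) \<and> (\<forall>i. \<omega> i i = 0) \<and>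
     (\<forall>i j. (i, j) \<in> {(x, y). 0 < \<omega> x y}\<^sup>*)"

definition deg :: "('v::finite \<Rightarrow> 'v \<Rightarrow> real) \<Rightarrow> 'v \<Rightarrow> real" where
  "deg \<omega> i = (\<Sum>j\<in>UNIV. \<omega> i j)"

text \<open>d_i to the power r, with the convention 0 to the power 0 equal to 1.\<close>
definition dpow :: "('v::finite \<Rightarrow> 'v \<Rightarrow> real) \<Rightarrow> real \<Rightarrow> 'v \<Rightarrow> real" where
  "dpow \<omega> r i = (if r = 0 then 1 else deg \<omega> i powr r)"

definition ipV :: "('v::finite \<Rightarrow> 'v \<Rightarrow> real) \<Rightarrow> real \<Rightarrow> ('v \<Rightarrow> real) \<Rightarrow> ('v \<Rightarrow> real) \<Rightarrow> real" where
  "ipV \<omega> r u v = (\<Sum>i\<in>UNIV. u i * v i * dpow \<omega> r i)"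

definition massV :: "('v::finite \<Rightarrow> 'v \<Rightarrow> real) \<Rightarrow> real \<Rightarrow> ('v \<Rightarrow> real) \<Rightarrow> real" where
  "massV \<omega> r u = ipV \<omega> r u (\<lambda>_. 1)"

definition meanV :: "('v::finite \<Rightarrow> 'v \<Rightarrow> real) \<Rightarrow> real \<Rightarrow> ('v \<Rightarrow> real) \<Rightarrow> real" where
  "meanV \<omega> r v = massV \<omega> r v / massV \<omega> r (\<lambda>_. 1)"

definition lap :: "('v::finite \<Rightarrow> 'v \<Rightarrow> real) \<Rightarrow> real \<Rightarrow> ('v \<Rightarrow> real) \<Rightarrow> 'v \<Rightarrow> real" where
  "lap \<omega> r u i = inverse (dpow \<omega> r i) * (\<Sum>j\<in>UNIV. \<omega> i j * (u i - u j))"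

text \<open>The matrix exponential e^(-tau Delta) applied to u, as its (convergent) power series.\<close>
definition heat :: "('v::finite \<Rightarrow> 'v \<Rightarrow> real) \<Rightarrow> real \<Rightarrow> real \<Rightarrow> ('v \<Rightarrow> real) \<Rightarrow> 'v \<Rightarrow> real" where
  "heat \<omega> r \<tau> u i = (\<Sum>k. ((- \<tau>) ^ k / fact k) * ((lap \<omega> r ^^ k) u) i)"

text \<open>beta in B(u); B(u) is empty unless u is [0,1]-valued.\<close>
definition inB :: "('v \<Rightarrow> real) \<Rightarrow> ('v \<Rightarrow> real) \<Rightarrow> bool" where
  "inB u \<beta> \<longleftrightarrow> (\<forall>i. 0 \<le> u i \<and> u i \<le> 1) \<and>
     (\<forall>i. (u i = 0 \<longrightarrow> 0 \<le> \<beta> i) \<and> (0 < u i \<and> u i < 1 \<longrightarrow> \<beta> i = 0) \<and> (u i = 1 \<longrightarrow> \<beta> i \<le> 0))"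

definition semi_iter :: "('v::finite \<Rightarrow> 'v \<Rightarrow> real) \<Rightarrow> real \<Rightarrow> real \<Rightarrow> real \<Rightarrow>
    (nat \<Rightarrow> 'v \<Rightarrow> real) \<Rightarrow> (nat \<Rightarrow> 'v \<Rightarrow> real) \<Rightarrow> bool" where
  "semi_iter \<omega> r \<epsilon> \<tau> u \<beta> \<longleftrightarrow>
     (\<forall>m. inB (u (Suc m)) (\<beta> (Suc m)) \<and>
        (\<forall>i. u (Suc m) i - heat \<omega> r \<tau> (u m) i - (\<tau> / \<epsilon>) * u (Suc m) i
               + (\<tau> / \<epsilon>) * meanV \<omega> r (u (Suc m))
             = (\<tau> / \<epsilon>) * \<beta> (Suc m) i - (\<tau> / \<epsilon>) * meanV \<omega> r (\<beta> (Suc m))))"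

section \<open>Function spaces in time\<close>

definition L2_on :: "real set \<Rightarrow> (real \<Rightarrow> real) \<Rightarrow> bool" where
  "L2_on S f \<longleftrightarrow> f \<in> borel_measurable (lebesgue_on S) \<and> integrable (lebesgue_on S) (\<lambda>t. (f t)\<^sup>2)"

definition L1_on :: "real set \<Rightarrow> (real \<Rightarrow> real) \<Rightarrow> bool" where
  "L1_on S f \<longleftrightarrow> integrable (lebesgue_on S) f"

definition Linf_on :: "real set \<Rightarrow> (real \<Rightarrow> real) \<Rightarrow> bool" where
  "Linf_on S f \<longleftrightarrow> f \<in> borel_measurable (lebesgue_on S) \<and> (\<exists>M. AE t in lebesgue_on S. \<bar>f t\<bar> \<le> M)"

text \<open>Smooth test functions compactly supported in the open interval (a,b).\<close>
definition test_fun :: "real \<Rightarrow> real \<Rightarrow> (real \<Rightarrow> real) \<Rightarrow> bool" where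
  "test_fun a b \<phi> \<longleftrightarrow> (\<forall>k x. ((deriv ^^ k) \<phi>) differentiable (at x)) \<and>
     (\<exists>c d. a < c \<and> c \<le> d \<and> d < b \<and> (\<forall>x. x \<notin> {c..d} \<longrightarrow> \<phi> x = 0))"

text \<open>f in H^1((a,b)) with weak derivative g (g in L^2((a,b))).\<close>
definition H1_with_deriv :: "real \<Rightarrow> real \<Rightarrow> (real \<Rightarrow> real) \<Rightarrow> (real \<Rightarrow> real) \<Rightarrow> bool" where
  "H1_with_deriv a b f g \<longleftrightarrow> L2_on {a<..<b} f \<and> L2_on {a<..<b} g \<and>
     (\<forall>\<phi>. test_fun a b \<phi> \<longrightarrow>
        (LINT t|lebesgue_on {a<..<b}. f t * deriv \<phi> t) = - (LINT t|lebesgue_on {a<..<b}. g t * \<phi> t))"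

text \<open>Weak convergence in L^2_loc([0,inf);V) (the limit lies in L^2_loc).\<close>
definition weak_L2loc :: "('v::finite \<Rightarrow> 'v \<Rightarrow> real) \<Rightarrow> real \<Rightarrow>
    (nat \<Rightarrow> real \<Rightarrow> 'v \<Rightarrow> real) \<Rightarrow> (real \<Rightarrow> 'v \<Rightarrow> real) \<Rightarrow> bool" where
  "weak_L2loc \<omega> r f g \<longleftrightarrow> (\<forall>T>0.
     (\<forall>i. L2_on {0..T} (\<lambda>t. g t i)) \<and>
     (\<forall>\<phi>. (\<forall>i. L2_on {0..T} (\<lambda>t. \<phi> t i)) \<longrightarrow>
        (\<lambda>n. LINT t|lebesgue_on {0..T}. ipV \<omega> r (f n t) (\<phi> t))
          \<longlonglongrightarrow> (LINT t|lebesgue_on {0..T}. ipV \<omega> r (g t) (\<phi> t))))"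

text \<open>Weak-* convergence in L^inf_loc([0,inf);V) (the limit lies in L^inf_loc), with L^1 as predual.\<close>
definition weakstar_Linfloc :: "('v::finite \<Rightarrow> 'v \<Rightarrow> real) \<Rightarrow> real \<Rightarrow>
    (nat \<Rightarrow> real \<Rightarrow> 'v \<Rightarrow> real) \<Rightarrow> (real \<Rightarrow> 'v \<Rightarrow> real) \<Rightarrow> bool" where
  "weakstar_Linfloc \<omega> r f g \<longleftrightarrow> (\<forall>T>0.
     (\<forall>i. Linf_on {0..T} (\<lambda>t. g t i)) \<and>
     (\<forall>\<phi>. (\<forall>i. L1_on {0..T} (\<lambda>t. \<phi> t i)) \<longrightarrow>
        (\<lambda>n. LINT t|lebesgue_on {0..T}. ipV \<omega> r (f n t) (\<phi> t))
          \<longlonglongrightarrow> (LINT t|lebesgue_on {0..T}. ipV \<omega> r (g t) (\<phi> t))))"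

text \<open>Solution of mass-conserving double-obstacle AC flow on [0,inf). The function du
  is the (a.e. unique) weak derivative du/dt.\<close>
definition AC_solution :: "('v::finite \<Rightarrow> 'v \<Rightarrow> real) \<Rightarrow> real \<Rightarrow> real \<Rightarrow>
    (real \<Rightarrow> 'v \<Rightarrow> real) \<Rightarrow> (real \<Rightarrow> 'v \<Rightarrow> real) \<Rightarrow> bool" where
  "AC_solution \<omega> r \<epsilon> u \<beta> \<longleftrightarrow>
     (\<exists>du. (\<forall>a b i. 0 \<le> a \<and> a < b \<longrightarrow> H1_with_deriv a b (\<lambda>t. u t i) (\<lambda>t. du t i)) \<and>
        (\<forall>i. continuous_on {0..} (\<lambda>t. u t i)) \<and>
        (\<forall>t\<ge>0. \<forall>i. 0 \<le> u t i \<and> u t i \<le> 1) \<and>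
        (AE t in lborel. 0 \<le> t \<longrightarrow>
           (\<forall>i. \<epsilon> * du t i + \<epsilon> * lap \<omega> r (u t) i - u t i + meanV \<omega> r (u t)
                 = \<beta> t i - meanV \<omega> r (\<beta> t)) \<and> inB (u t) (\<beta> t)))"

end

theory Submission
  imports Defs "HOL-Complex_Analysis.Great_Picard"
begin

text \<open>
  The spatially constant multiplier in the scheme is controlled by mass conservation: if it were too
  large, every value below 1 would increase, and symmetrically. Hence the obstacle terms
  \<open>\<beta>\<close> are bounded uniformly in the time step and the iterates are Lipschitz up to \<open>O(\<tau>)\<close>, so the
  piecewise constant interpolants converge pointwise along a subsequence. The \<open>\<beta>\<close>-interpolants
  converge weakly along a further subsequence, which a Banach--Saks argument refines so that arithmetic
  means converge almost everywhere; this limit \<open>\<gamma>\<close> is also the weak limit. Summing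
  the scheme gives an integral equation whose two sides pass to the limit, and the sign conditions on
  \<open>\<gamma>\<close> survive because \<open>\<beta>\<close> has the right sign eventually wherever the limit avoids an obstacle.
\<close>

section \<open>A priori estimates for the scheme\<close>

text \<open>In the scheme \<beta> enters only as \<beta> minus its mean, so its size cannot be read
  off the equation. At the constant states 0 and 1 it is genuinely unbounded (for u = 0 any
  nonnegative constant \<beta> solves the step), hence the exclusion of these initial states must be
  carried through every step. The bounds hold with one constant for all steps and all times, which
  is why a single subsequence can serve the whole half-line. The obstacle to taking limits is that
  membership in B(u) is a condition at single times, which weak convergence does not see. Arithmetic
  means inherit signs and do converge at almost every time. They also supply the weak limit as an
  actual function: averaging does not change the limit of a convergent sequence of integrals, so the
  integrals against \<gamma> must agree with it, and no representation theorem for functionals is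
  used.\<close>

lemma weighted_graph_deg_pos:
  assumes wg: "weighted_graph \<omega>" and ij: "j \<noteq> i"
  shows "0 < deg \<omega> i"
proof -
  have nn: "0 \<le> \<omega> x y" for x y
    using wg by (auto simp: weighted_graph_def)
  have "(i, j) \<in> {(x, y). 0 < \<omega> x y}\<^sup>*"
    using wg by (auto simp: weighted_graph_def)
  then obtain k where "0 < \<omega> i k"
    using ij by (cases rule: converse_rtranclE) auto
  then show ?thesis
    unfolding deg_def using nn by (intro sum_pos2[of _ k]) auto
qed

lemma dpow_nonneg: "0 \<le> dpow \<omega> r i"
  by (simp add: dpow_def)

text \<open>The degenerate second alternative is a single vertex with \<open>r > 0\<close>, where the total mass is
  zero and the mean is the junk value \<open>x / 0 = 0\<close>.\<close>
lemma dpow_pos_or_meanV_zero: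
  assumes wg: "weighted_graph (\<omega> :: 'v::finite \<Rightarrow> 'v \<Rightarrow> real)"
  shows "(\<forall>i. 0 < dpow \<omega> r i) \<or> (\<forall>v. meanV \<omega> r v = 0)"
proof (cases "\<exists>i j :: 'v. i \<noteq> j")
  case True
  then have d: "0 < deg \<omega> i" for i
    using weighted_graph_deg_pos[OF wg] by metis
  have "0 < dpow \<omega> r i" for i
    using d[of i] by (simp add: dpow_def)
  then show ?thesis
    by simp
next
  case False
  then have U: "(UNIV :: 'v set) = {i}" for i
    by auto
  have "deg \<omega> i = 0" for i
    using wg by (simp add: deg_def U[of i] weighted_graph_def)
  then show ?thesis
    by (auto simp: dpow_def meanV_def massV_def ipV_def)
qed

text \<open>As a linear combination with fixed coefficients, the mean passes through sums,
  integrals, limits and measurability by generic rules. Zero total mass is covered, since all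
  coefficients are then \<open>x / 0 = 0\<close>.\<close>

lemma meanV_eq_sum: "meanV \<omega> r v = (\<Sum>i\<in>UNIV. dpow \<omega> r i / massV \<omega> r (\<lambda>_. 1) * v i)"
  by (simp add: meanV_def massV_def ipV_def sum_divide_distrib mult.commute)

lemma abs_meanV_le:
  assumes "\<And>i. \<bar>v i\<bar> \<le> C"
  shows "\<bar>meanV \<omega> r v\<bar> \<le> C"
proof -
  have C: "0 \<le> C"
    using assms[of undefined] by linarith
  have "\<bar>\<Sum>i\<in>UNIV. v i * 1 * dpow \<omega> r i\<bar> \<le> (\<Sum>i\<in>UNIV. C * dpow \<omega> r i)"
    using assms by (intro order_trans[OF sum_abs] sum_mono)
      (auto simp: abs_mult dpow_nonneg intro!: mult_right_mono)
  then have "\<bar>massV \<omega> r v\<bar> \<le> C * massV \<omega> r (\<lambda>_. 1)"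
    by (simp add: massV_def ipV_def sum_distrib_left)
  moreover have "0 \<le> massV \<omega> r (\<lambda>_. 1)"
    by (simp add: massV_def ipV_def sum_nonneg dpow_nonneg)
  ultimately show ?thesis
    using C by (cases "massV \<omega> r (\<lambda>_. 1) = 0") (simp_all add: meanV_def abs_divide divide_le_eq)
qed

lemma meanV_add: "meanV \<omega> r (\<lambda>i. u i + v i) = meanV \<omega> r u + meanV \<omega> r v"
  by (simp only: meanV_eq_sum distrib_left sum.distrib)

lemma meanV_cmult: "meanV \<omega> r (\<lambda>i. c * v i) = c * meanV \<omega> r v"
  by (simp add: meanV_eq_sum sum_distrib_left algebra_simps)

text \<open>A crude bound for the operator norm of the Laplacian in the sup norm: the factor 2 comes
  from \<open>u i - u j\<close>, and the sum over all rows replaces the largest row sum.\<close>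

definition lap_bound :: "('v::finite \<Rightarrow> 'v \<Rightarrow> real) \<Rightarrow> real \<Rightarrow> real" where
  "lap_bound \<omega> r = (\<Sum>i\<in>UNIV. \<Sum>j\<in>UNIV. 2 * \<bar>inverse (dpow \<omega> r i) * \<omega> i j\<bar>)"

lemma lap_bound_nonneg: "0 \<le> lap_bound \<omega> r"
  by (simp add: lap_bound_def sum_nonneg)

lemma abs_lap_le:
  assumes "\<And>j. \<bar>u j\<bar> \<le> C"
  shows "\<bar>lap \<omega> r u i\<bar> \<le> lap_bound \<omega> r * C"
proof -
  have C: "0 \<le> C"
    using assms[of undefined] by linarith
  have "lap \<omega> r u i = (\<Sum>j\<in>UNIV. inverse (dpow \<omega> r i) * \<omega> i j * (u i - u j))"
    by (simp add: lap_def sum_distrib_left mult.assoc)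
  also have "\<bar>\<dots>\<bar> \<le> (\<Sum>j\<in>UNIV. \<bar>inverse (dpow \<omega> r i) * \<omega> i j\<bar> * \<bar>u i - u j\<bar>)"
    by (rule order_trans[OF sum_abs]) (simp add: abs_mult)
  also have "\<dots> \<le> (\<Sum>j\<in>UNIV. \<bar>inverse (dpow \<omega> r i) * \<omega> i j\<bar> * (2 * C))"
  proof (intro sum_mono mult_left_mono)
    fix j show "\<bar>u i - u j\<bar> \<le> 2 * C"
      using assms[of i] assms[of j] by linarith
  qed simp
  also have "\<dots> = (\<Sum>j\<in>UNIV. 2 * \<bar>inverse (dpow \<omega> r i) * \<omega> i j\<bar>) * C"
    by (simp add: sum_distrib_right sum_distrib_left mult_ac)
  also have "\<dots> \<le> lap_bound \<omega> r * C"
    unfolding lap_bound_def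
    by (intro mult_right_mono C member_le_sum[of i UNIV "\<lambda>i. \<Sum>j\<in>UNIV. 2 * \<bar>inverse (dpow \<omega> r i) * \<omega> i j\<bar>"])
       (auto intro: sum_nonneg)
  finally show ?thesis .
qed

lemma lap_diff: "lap \<omega> r (\<lambda>i. u i - v i) i = lap \<omega> r u i - lap \<omega> r v i"
  by (simp add: lap_def algebra_simps sum_subtractf sum.distrib)

section \<open>The heat operator as a power series\<close>

lemma abs_lap_funpow_le:
  assumes "\<And>j. \<bar>u j\<bar> \<le> C"
  shows "\<bar>(lap \<omega> r ^^ k) u i\<bar> \<le> lap_bound \<omega> r ^ k * C"
proof (induction k arbitrary: i)
  case (Suc k)
  show ?case
    using abs_lap_le[of "(lap \<omega> r ^^ k) u", OF Suc.IH] by (simp add: mult.assoc)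
qed (use assms in simp)

lemma heat_term_le:
  assumes "\<And>j. \<bar>u j\<bar> \<le> C" "0 \<le> \<tau>"
  shows "\<bar>(- \<tau>) ^ k / fact k * ((lap \<omega> r ^^ k) u) i\<bar> \<le> (\<tau> * lap_bound \<omega> r) ^ k / fact k * C"
proof -
  have "\<bar>(- \<tau>) ^ k / fact k * ((lap \<omega> r ^^ k) u) i\<bar> = \<tau> ^ k / fact k * \<bar>((lap \<omega> r ^^ k) u) i\<bar>"
    using assms(2) by (simp add: abs_mult power_abs)
  also have "\<dots> \<le> \<tau> ^ k / fact k * (lap_bound \<omega> r ^ k * C)"
    using assms by (intro mult_left_mono abs_lap_funpow_le) auto
  finally show ?thesis
    by (simp add: power_mult_distrib)
qed

lemma summable_heat:
  fixes u :: "'v::finite \<Rightarrow> real"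
  assumes "0 \<le> \<tau>"
  shows "summable (\<lambda>k. (- \<tau>) ^ k / fact k * ((lap \<omega> r ^^ k) u) i)"
proof -
  define C where "C = (\<Sum>j\<in>UNIV. \<bar>u j\<bar>)"
  have C: "\<bar>u j\<bar> \<le> C" for j
    unfolding C_def by (rule member_le_sum) auto
  show ?thesis
  proof (rule summable_comparison_test')
    show "summable (\<lambda>k. (\<tau> * lap_bound \<omega> r) ^ k / fact k * C)"
      using summable_exp[of "\<tau> * lap_bound \<omega> r"] by (intro summable_mult2) (simp add: field_simps)
    show "norm ((- \<tau>) ^ n / fact n * ((lap \<omega> r ^^ n) u) i) \<le> (\<tau> * lap_bound \<omega> r) ^ n / fact n * C" for n
      using heat_term_le[of u C \<tau> n \<omega> r i] C assms by simp
  qed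
qed

text \<open>This is the tail of the exponential series from index 2 on. The quadratic order in
  \<tau> matters: summed over about t / \<tau> steps, the error still vanishes.\<close>

lemma heat_expansion:
  assumes u: "\<And>j. \<bar>u j\<bar> \<le> C" and \<tau>: "0 \<le> \<tau>"
  shows "\<bar>heat \<omega> r \<tau> u i - (u i - \<tau> * lap \<omega> r u i)\<bar>
           \<le> C * ((\<tau> * lap_bound \<omega> r)\<^sup>2 * exp (\<tau> * lap_bound \<omega> r))"
proof -
  define x where "x = \<tau> * lap_bound \<omega> r"
  have x: "0 \<le> x"
    by (simp add: x_def \<tau> lap_bound_nonneg)
  have C: "0 \<le> C"
    using u[of undefined] by linarith
  define f where "f k = (- \<tau>) ^ k / fact k * ((lap \<omega> r ^^ k) u) i" for k
  have f: "summable f"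
    unfolding f_def by (rule summable_heat[OF \<tau>])
  have "heat \<omega> r \<tau> u i = (\<Sum>k. f (k + 2)) + (\<Sum>k<2. f k)"
    unfolding heat_def f_def[symmetric] by (rule suminf_split_initial_segment[OF f])
  then have eq: "heat \<omega> r \<tau> u i - (u i - \<tau> * lap \<omega> r u i) = (\<Sum>k. f (k + 2))"
    by (simp add: f_def numeral_2_eq_2)
  have le: "\<bar>f (k + 2)\<bar> \<le> C * x\<^sup>2 * (x ^ k / fact k)" for k
  proof -
    have "\<bar>f (k + 2)\<bar> \<le> x ^ (k + 2) / fact (k + 2) * C"
      unfolding f_def x_def using heat_term_le[OF u \<tau>] .
    \<comment> \<open>Replacing (k + 2)! by k! turns the tail into x^2 times the series of
      \<open>exp x\<close>.\<close>
    also have "\<dots> \<le> x ^ (k + 2) / fact k * C"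
      using x C by (intro mult_right_mono divide_left_mono fact_mono) auto
    finally show ?thesis
      by (simp add: power_add power2_eq_square mult_ac)
  qed
  have e: "(\<lambda>k. x ^ k / fact k) sums exp x"
    using exp_converges[of x] by (simp add: field_simps)
  have g: "(\<lambda>k. C * x\<^sup>2 * (x ^ k / fact k)) sums (C * x\<^sup>2 * exp x)"
    using sums_mult[OF e] .
  have s: "summable (\<lambda>k. \<bar>f (k + 2)\<bar>)"
    using le by (intro summable_comparison_test'[OF sums_summable[OF g]]) auto
  have "\<bar>\<Sum>k. f (k + 2)\<bar> \<le> (\<Sum>k. \<bar>f (k + 2)\<bar>)"
    by (rule summable_rabs[OF s])
  also have "\<dots> \<le> (\<Sum>k. C * x\<^sup>2 * (x ^ k / fact k))"
    by (rule suminf_le[OF le s sums_summable[OF g]])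
  also have "\<dots> = C * x\<^sup>2 * exp x"
    using g by (rule sums_unique[symmetric])
  finally show ?thesis
    by (simp add: eq x_def mult.assoc)
qed

text \<open>The weight \<open>dpow \<omega> r i\<close> of the inner product cancels the inverse
  factor in \<open>lap\<close>, for which it must be nonzero; the remaining double sum is
  antisymmetric in i and j.\<close>

lemma meanV_lap:
  assumes wg: "weighted_graph \<omega>" and d: "\<And>i. 0 < dpow \<omega> r i"
  shows "meanV \<omega> r (lap \<omega> r u) = 0"
proof -
  have sym: "\<omega> i j = \<omega> j i" for i j
    using wg by (simp add: weighted_graph_def)
  have "(\<Sum>i\<in>UNIV. \<Sum>j\<in>UNIV. \<omega> i j * u j) = (\<Sum>i\<in>UNIV. \<Sum>j\<in>UNIV. \<omega> i j * u i)"
    by (subst sum.swap) (simp add: sym)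
  then have "(\<Sum>i\<in>UNIV. \<Sum>j\<in>UNIV. \<omega> i j * (u i - u j)) = 0"
    by (simp add: algebra_simps sum_subtractf)
  moreover have "lap \<omega> r u i * 1 * dpow \<omega> r i = (\<Sum>j\<in>UNIV. \<omega> i j * (u i - u j))" for i
    using d[of i] by (simp add: lap_def)
  ultimately show ?thesis
    by (simp add: meanV_def massV_def ipV_def)
qed

text \<open>By \<open>meanV_lap\<close>, only the term k = 0 of the exponential series has a mean
  that can be nonzero.\<close>

lemma meanV_heat:
  assumes wg: "weighted_graph \<omega>" and \<tau>: "0 \<le> \<tau>" and d: "\<And>i. 0 < dpow \<omega> r i"
  shows "meanV \<omega> r (heat \<omega> r \<tau> u) = meanV \<omega> r u"
proof -
  let ?w = "\<lambda>i. dpow \<omega> r i / massV \<omega> r (\<lambda>_. 1)"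
  let ?f = "\<lambda>k i. (- \<tau>) ^ k / fact k * ((lap \<omega> r ^^ k) u) i"
  have mean: "meanV \<omega> r ((lap \<omega> r ^^ k) u) = 0" if "k \<noteq> 0" for k
    using that meanV_lap[OF wg d] by (cases k) auto
  have "meanV \<omega> r (heat \<omega> r \<tau> u) = (\<Sum>i\<in>UNIV. \<Sum>k. ?w i * ?f k i)"
    unfolding meanV_eq_sum heat_def
    by (intro sum.cong refl suminf_mult[symmetric] summable_heat[OF \<tau>])
  also have "\<dots> = (\<Sum>k. \<Sum>i\<in>UNIV. ?w i * ?f k i)"
    by (intro suminf_sum[symmetric] summable_mult summable_heat[OF \<tau>])
  also have "\<dots> = (\<Sum>k. meanV \<omega> r (\<lambda>i. ?f k i))"
    by (simp only: meanV_eq_sum)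
  also have "\<dots> = (\<Sum>k. (- \<tau>) ^ k / fact k * meanV \<omega> r ((lap \<omega> r ^^ k) u))"
    by (simp only: meanV_cmult)
  also have "\<dots> = (\<Sum>k\<in>{0}. (- \<tau>) ^ k / fact k * meanV \<omega> r ((lap \<omega> r ^^ k) u))"
    by (rule suminf_finite) (auto simp: mean)
  finally show ?thesis
    by simp
qed

section \<open>Strict monotonicity of the mean, bounds for the multiplier and the obstacle
  terms\<close>

lemma meanV_strict_mono:
  assumes d: "\<And>i. 0 < dpow \<omega> r i" and le: "\<And>i. u i \<le> v i" and j: "u j < v j"
  shows "meanV \<omega> r u < meanV \<omega> r v"
proof -
  have "(\<Sum>i\<in>UNIV. u i * 1 * dpow \<omega> r i) < (\<Sum>i\<in>UNIV. v i * 1 * dpow \<omega> r i)"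
    using assms by (intro sum_strict_mono_ex1) (auto intro!: bexI[of _ j])
  moreover have "0 < massV \<omega> r (\<lambda>_. 1)"
    by (auto simp: massV_def ipV_def d intro!: sum_pos)
  ultimately show ?thesis
    by (simp add: meanV_def massV_def ipV_def divide_strict_right_mono)
qed

lemma meanV_const:
  assumes d: "\<And>i. 0 < dpow \<omega> r i"
  shows "meanV \<omega> r (\<lambda>_. 1) = 1"
proof -
  have "0 < massV \<omega> r (\<lambda>_. 1)"
    by (auto simp: massV_def ipV_def d intro!: sum_pos)
  then show ?thesis
    by (simp add: meanV_def)
qed

text \<open>The mean detects the two constant states. As the scheme conserves the mean, this passes
  the exclusion of 0 and 1 from the initial state on to all iterates.\<close>

lemma meanV_interior:
  assumes d: "\<And>i. 0 < dpow \<omega> r i" and u: "\<And>i. 0 \<le> u i \<and> u i \<le> 1"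
  shows "u \<noteq> (\<lambda>_. 0) \<longleftrightarrow> 0 < meanV \<omega> r u" "u \<noteq> (\<lambda>_. 1) \<longleftrightarrow> meanV \<omega> r u < 1"
proof -
  have 0: "meanV \<omega> r (\<lambda>_. 0) = 0"
    using meanV_cmult[of \<omega> r 0 u] by simp
  have 1: "meanV \<omega> r (\<lambda>_. 1) = 1"
    by (rule meanV_const[OF d])
  have a: "0 < meanV \<omega> r u" if ne: "u \<noteq> (\<lambda>_. 0)"
  proof -
    obtain j where "u j \<noteq> 0" using ne by auto
    then have "0 < u j" using u[of j] by linarith
    then show ?thesis
      using meanV_strict_mono[of \<omega> r "\<lambda>_. 0" u j, OF d] u by (simp add: 0)
  qed
  have b: "meanV \<omega> r u < 1" if ne: "u \<noteq> (\<lambda>_. 1)"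
  proof -
    obtain j where "u j \<noteq> 1" using ne by auto
    then have "u j < 1" using u[of j] by linarith
    then show ?thesis
      using meanV_strict_mono[of \<omega> r u "\<lambda>_. 1" j, OF d] u by (simp add: 1)
  qed
  show "u \<noteq> (\<lambda>_. 0) \<longleftrightarrow> 0 < meanV \<omega> r u" using a 0 by auto
  show "u \<noteq> (\<lambda>_. 1) \<longleftrightarrow> meanV \<omega> r u < 1" using b 1 by auto
qed

text \<open>If the shift \<open>c\<close> exceeded \<open>\<delta>\<close>, then every value below 1 would strictly increase, and if it were
  below \<open>- l - \<delta>\<close>, every value above 0 would strictly decrease; both contradict mass conservation.\<close>
lemma multiplier_bound:
  assumes d: "\<And>i. 0 < dpow \<omega> r i" and l: "0 < l" "l < 1" and B: "inB u' \<beta>"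
    and u: "\<And>i. 0 \<le> u i \<and> u i \<le> 1" and ne: "u \<noteq> (\<lambda>_. 0)" "u \<noteq> (\<lambda>_. 1)"
    and eq: "\<And>i. (1 - l) * u' i = v i + c + l * \<beta> i"
    and v: "\<And>i. \<bar>v i - u i\<bar> \<le> \<delta>" and mass: "meanV \<omega> r u' = meanV \<omega> r u"
  shows "- l - \<delta> \<le> c" "c \<le> \<delta>"
proof -
  have u': "0 \<le> u' i" "u' i \<le> 1" for i
    using B by (auto simp: inB_def)
  have shrink: "(1 - l) * u' i \<le> u' i" for i
    using u'[of i] l by (simp add: mult_left_le_one_le)
  show "c \<le> \<delta>"
  proof (rule ccontr)
    assume c: "\<not> c \<le> \<delta>"
    have up: "u i < u' i \<or> u' i = 1" for i
    proof (cases "u' i = 1")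
      case False
      then have "0 \<le> \<beta> i"
        using B u'[of i] by (auto simp: inB_def less_le)
      then have "0 \<le> l * \<beta> i"
        using l by simp
      then show ?thesis
        using eq[of i] v[of i] c shrink[of i] by (auto simp: abs_le_iff)
    qed simp
    obtain j where "u j \<noteq> 1" using ne by auto
    then have "u j < u' j" using up[of j] u[of j] by auto
    moreover have "u i \<le> u' i" for i using up[of i] u[of i] by auto
    ultimately have "meanV \<omega> r u < meanV \<omega> r u'"
      by (intro meanV_strict_mono[OF d])
    then show False using mass by simp
  qed
  show "- l - \<delta> \<le> c"
  proof (rule ccontr)
    assume c: "\<not> - l - \<delta> \<le> c"
    have down: "u' i < u i \<or> u' i = 0" for i
    proof (cases "u' i = 0")
      case False
      then have "\<beta> i \<le> 0"
        using B u'[of i] by (auto simp: inB_def less_le)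
      then have "l * \<beta> i \<le> 0"
        using l by (simp add: mult_nonneg_nonpos)
      \<comment> \<open>This is the source of the extra l in the lower bound: solved for u', the
        step reads u' = v + c + l \<beta> + l u', and the last term can raise u' by up to l.\<close>
      moreover have "l * u' i \<le> l"
        using l u'[of i] by (simp add: mult_left_le)
      ultimately show ?thesis
        using eq[of i] v[of i] c by (auto simp: abs_le_iff algebra_simps)
    qed simp
    obtain j where "u j \<noteq> 0" using ne by auto
    then have "u' j < u j" using down[of j] u[of j] by auto
    moreover have "u' i \<le> u i" for i using down[of i] u[of i] by auto
    ultimately have "meanV \<omega> r u' < meanV \<omega> r u"
      by (intro meanV_strict_mono[OF d])
    then show False using mass by simp
  qed
qed

text \<open>A nonzero \<beta> forces u' to be 0 or 1, so l \<beta> equals -v - c or 1 - l - v - c.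
  Its sign is known, and the opposite side is bounded because v is within \<delta> of [0,1] and c is
  controlled. With \<delta> of order l, division by l leaves a bound independent of the
  step.\<close>

lemma obstacle_bound:
  assumes l: "0 < l" "l < 1" and B: "inB u' \<beta>" and u: "\<And>i. 0 \<le> u i \<and> u i \<le> 1"
    and eq: "\<And>i. (1 - l) * u' i = v i + c + l * \<beta> i"
    and v: "\<And>i. \<bar>v i - u i\<bar> \<le> \<delta>" and c: "- l - \<delta> \<le> c" "c \<le> \<delta>"
  shows "l * \<bar>\<beta> i\<bar> \<le> l + 2 * \<delta>"
proof -
  have \<delta>: "0 \<le> \<delta>"
    using v[of undefined] by linarith
  have "\<bar>l * \<beta> i\<bar> \<le> l + 2 * \<delta>"
  proof (cases "\<beta> i = 0")
    case False
    then have "u' i = 0 \<and> 0 < \<beta> i \<or> u' i = 1 \<and> \<beta> i < 0"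
      using B by (force simp: inB_def less_le)
    then have "u' i = 0 \<and> 0 < l * \<beta> i \<or> u' i = 1 \<and> l * \<beta> i < 0"
      using l by (auto simp: mult_pos_neg)
    then show ?thesis
      using eq[of i] v[of i] c u[of i] by (auto simp: abs_le_iff)
  qed (use l \<delta> in simp)
  then show ?thesis
    using l by (simp add: abs_mult)
qed

text \<open>The flow equation solved for \<epsilon> du/dt, so that the scheme and the limit equation
  can be compared through one expression.\<close>

definition flow_rhs :: "('v::finite \<Rightarrow> 'v \<Rightarrow> real) \<Rightarrow> real \<Rightarrow> real \<Rightarrow> ('v \<Rightarrow> real) \<Rightarrow> ('v \<Rightarrow> real) \<Rightarrow> 'v \<Rightarrow> real" where
  "flow_rhs \<omega> r \<epsilon> u \<beta> i = u i - meanV \<omega> r u + \<beta> i - meanV \<omega> r \<beta> - \<epsilon> * lap \<omega> r u i"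

text \<open>K is chosen before \<sigma> and the iterates and is uniform in both. The last estimate
  is the local consistency error of the scheme, read as an implicit Euler step for the flow.\<close>

lemma semi_iter_estimates:
  fixes \<omega> :: "'v::finite \<Rightarrow> 'v \<Rightarrow> real"
  assumes wg: "weighted_graph \<omega>" and \<epsilon>: "0 < \<epsilon>"
    and u0: "\<And>i. 0 \<le> u0 i \<and> u0 i \<le> 1" "u0 \<noteq> (\<lambda>_. 0)" "u0 \<noteq> (\<lambda>_. 1)"
  shows "\<exists>K\<ge>0. \<forall>\<sigma> u \<beta>. 0 < \<sigma> \<and> \<sigma> < \<epsilon> \<and> semi_iter \<omega> r \<epsilon> \<sigma> u \<beta> \<and> u 0 = u0 \<longrightarrow> (\<forall>m i.
       (0 \<le> u m i \<and> u m i \<le> 1) \<and> \<bar>\<beta> (Suc m) i\<bar> \<le> K \<and> \<bar>u (Suc m) i - u m i\<bar> \<le> K * \<sigma> \<and>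
       \<bar>\<epsilon> * (u (Suc m) i - u m i) - \<sigma> * flow_rhs \<omega> r \<epsilon> (u (Suc m)) (\<beta> (Suc m)) i\<bar> \<le> K * \<sigma>\<^sup>2)"
proof -
  \<comment> \<open>C and D are the constants of the first- and second-order heat errors, M bounds
    \<beta>, P is the Lipschitz constant of the iterates and Q the consistency constant. Surplus
    powers of \<sigma> are absorbed by \<sigma> < \<epsilon>.\<close>
  define L where "L = lap_bound \<omega> r"
  define D where "D = L\<^sup>2 * exp (\<epsilon> * L)"
  define C where "C = L + \<epsilon> * D"
  define M where "M = 1 + 2 * C * \<epsilon>"
  define P where "P = C + (2 + 2 * M) / \<epsilon>"
  define Q where "Q = \<epsilon> * (D + L * P)"
  define K where "K = M + P + Q"
  have L: "0 \<le> L" by (simp add: L_def lap_bound_nonneg)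
  have nn: "0 \<le> D" "0 \<le> C" "0 \<le> M" "0 \<le> P" "0 \<le> Q"
  proof -
    show D: "0 \<le> D" by (simp add: D_def)
    then show C: "0 \<le> C" using L \<epsilon> by (simp add: C_def)
    then show M: "0 \<le> M" using \<epsilon> by (simp add: M_def)
    then show P: "0 \<le> P" using C \<epsilon> by (simp add: P_def)
    then show "0 \<le> Q" using L D \<epsilon> by (simp add: Q_def)
  qed
  have main: "(0 \<le> u m i \<and> u m i \<le> 1) \<and> \<bar>\<beta> (Suc m) i\<bar> \<le> M \<and> \<bar>u (Suc m) i - u m i\<bar> \<le> P * \<sigma> \<and>
       \<bar>\<epsilon> * (u (Suc m) i - u m i) - \<sigma> * flow_rhs \<omega> r \<epsilon> (u (Suc m)) (\<beta> (Suc m)) i\<bar> \<le> Q * \<sigma>\<^sup>2"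
    if \<sigma>: "0 < \<sigma>" "\<sigma> < \<epsilon>" and it: "semi_iter \<omega> r \<epsilon> \<sigma> u \<beta>" and start: "u 0 = u0" for \<sigma> u \<beta> m i
  proof -
    define l where "l = \<sigma> / \<epsilon>"
    have l: "0 < l" "l < 1"
      using \<sigma> by (auto simp: l_def)
    have B: "inB (u (Suc n)) (\<beta> (Suc n))" for n
      using it by (simp add: semi_iter_def)
    have step: "u (Suc n) j - heat \<omega> r \<sigma> (u n) j - l * u (Suc n) j + l * meanV \<omega> r (u (Suc n))
        = l * \<beta> (Suc n) j - l * meanV \<omega> r (\<beta> (Suc n))" for n j
      using it by (simp add: semi_iter_def l_def)
    have u01: "0 \<le> u n j \<and> u n j \<le> 1" for n j
      using B start u0(1) by (cases n) (auto simp: inB_def)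
    then have u1: "\<bar>u n j\<bar> \<le> 1" for n j
      by (simp add: abs_le_iff order_trans[of _ 0 1])
    have heat2: "\<bar>heat \<omega> r \<sigma> (u n) j - (u n j - \<sigma> * lap \<omega> r (u n) j)\<bar> \<le> D * \<sigma>\<^sup>2" for n j
    proof -
      have "\<bar>heat \<omega> r \<sigma> (u n) j - (u n j - \<sigma> * lap \<omega> r (u n) j)\<bar> \<le> 1 * ((\<sigma> * L)\<^sup>2 * exp (\<sigma> * L))"
        unfolding L_def using heat_expansion[of "u n" 1 \<sigma> \<omega> r j] u1 \<sigma> by simp
      also have "\<dots> \<le> 1 * ((\<sigma> * L)\<^sup>2 * exp (\<epsilon> * L))"
        using \<sigma> L by (intro mult_left_mono) (auto simp: mult_right_mono)
      finally show ?thesis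
        by (simp add: D_def power_mult_distrib mult_ac)
    qed
    have heat1: "\<bar>heat \<omega> r \<sigma> (u n) j - u n j\<bar> \<le> C * \<sigma>" for n j
    proof -
      have "\<bar>\<sigma> * lap \<omega> r (u n) j\<bar> \<le> \<sigma> * (L * 1)"
        unfolding L_def abs_mult using \<sigma> abs_lap_le[of "u n" 1 \<omega> r j] u1 by simp
      moreover have "D * \<sigma>\<^sup>2 \<le> D * (\<epsilon> * \<sigma>)"
        using \<sigma> nn by (intro mult_left_mono) (auto simp: power2_eq_square)
      ultimately show ?thesis
        using heat2[of n j] unfolding C_def by (auto simp: abs_le_iff algebra_simps)
    qed
    \<comment> \<open>All spatially constant terms of the step are collected in one scalar, the
      multiplier of \<open>multiplier_bound\<close>.\<close>
    define c where "c n = - l * (meanV \<omega> r (u (Suc n)) + meanV \<omega> r (\<beta> (Suc n)))" for n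
    have eq: "(1 - l) * u (Suc n) j = heat \<omega> r \<sigma> (u n) j + c n + l * \<beta> (Suc n) j" for n j
      using step[of n j] by (simp add: c_def algebra_simps)
    have c: "- l - C * \<sigma> \<le> c n \<and> c n \<le> C * \<sigma>" for n
    proof (cases "\<forall>i. 0 < dpow \<omega> r i")
      case True
      then have d: "0 < dpow \<omega> r i" for i by simp
      \<comment> \<open>On averaging the step, the means of \<beta> cancel against those inside
        \<open>c n\<close>, and so do the two terms carrying l times the new mean.\<close>
      have mass: "meanV \<omega> r (u (Suc n)) = meanV \<omega> r (u n)" for n
      proof -
        have "meanV \<omega> r (\<lambda>j. (1 - l) * u (Suc n) j)
            = meanV \<omega> r (\<lambda>j. heat \<omega> r \<sigma> (u n) j + c n * 1 + l * \<beta> (Suc n) j)"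
          by (simp add: eq)
        then have "(1 - l) * meanV \<omega> r (u (Suc n)) = meanV \<omega> r (u n) + c n + l * meanV \<omega> r (\<beta> (Suc n))"
          using meanV_heat[OF wg _ d, of \<sigma> "u n"] meanV_const[of \<omega> r, OF d] \<sigma>
          by (simp only: meanV_add meanV_cmult)
        then show ?thesis by (simp add: c_def algebra_simps)
      qed
      have "meanV \<omega> r (u n) = meanV \<omega> r u0"
        by (induction n) (simp_all add: start mass)
      then have ne: "u n \<noteq> (\<lambda>_. 0)" "u n \<noteq> (\<lambda>_. 1)"
        using meanV_interior[OF d, of u0] meanV_interior[OF d, of "u n"] u0 u01 by simp_all
      show ?thesis
        using multiplier_bound[OF d l B u01 ne eq heat1 mass] by simp
    next
      \<comment> \<open>Only the degenerate alternative with identically vanishing mean is left, and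
        there the multiplier is 0.\<close>
      case False
      then have "c n = 0"
        using dpow_pos_or_meanV_zero[OF wg, of r] by (auto simp: c_def)
      moreover have "0 \<le> C * \<sigma>"
        using nn \<sigma> by simp
      ultimately show ?thesis
        using l by simp
    qed
    have M: "\<bar>\<beta> (Suc n) j\<bar> \<le> M" for n j
    proof -
      have "l * \<bar>\<beta> (Suc n) j\<bar> \<le> l + 2 * (C * \<sigma>)"
        using obstacle_bound[OF l B u01 eq heat1] c by blast
      also have "\<dots> = l * M"
        using \<epsilon> by (simp add: M_def l_def field_simps)
      finally show ?thesis
        using l by simp
    qed
    have P: "\<bar>u (Suc n) j - u n j\<bar> \<le> P * \<sigma>" for n j
    proof -
      have "\<bar>u (Suc n) j - meanV \<omega> r (u (Suc n)) + \<beta> (Suc n) j - meanV \<omega> r (\<beta> (Suc n))\<bar> \<le> 2 + 2 * M"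
        using u1[of "Suc n" j] abs_meanV_le[of "u (Suc n)" 1 \<omega> r, OF u1] M[of n j]
          abs_meanV_le[of "\<beta> (Suc n)" M \<omega> r, OF M] by linarith
      then have "\<bar>l * (u (Suc n) j - meanV \<omega> r (u (Suc n)) + \<beta> (Suc n) j - meanV \<omega> r (\<beta> (Suc n)))\<bar>
          \<le> l * (2 + 2 * M)"
        using l by (simp add: abs_mult)
      moreover have "l * (2 + 2 * M) = (2 + 2 * M) / \<epsilon> * \<sigma>"
        by (simp add: l_def)
      moreover have "u (Suc n) j - u n j = heat \<omega> r \<sigma> (u n) j - u n j
          + l * (u (Suc n) j - meanV \<omega> r (u (Suc n)) + \<beta> (Suc n) j - meanV \<omega> r (\<beta> (Suc n)))"
        using step[of n j] by (simp add: algebra_simps)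
      ultimately show ?thesis
        using heat1[of n j] by (simp only: P_def distrib_right)
    qed
    have "\<bar>\<epsilon> * (u (Suc m) i - u m i) - \<sigma> * flow_rhs \<omega> r \<epsilon> (u (Suc m)) (\<beta> (Suc m)) i\<bar> \<le> Q * \<sigma>\<^sup>2"
    proof -
      \<comment> \<open>The scheme applies the Laplacian to the old state, \<open>flow_rhs\<close>
        to the new one. Their difference is O(\<sigma>) by the Lipschitz bound P, and a further
        factor \<sigma> makes it second order.\<close>
      have lap: "\<bar>lap \<omega> r (u (Suc m)) i - lap \<omega> r (u m) i\<bar> \<le> L * (P * \<sigma>)"
        unfolding L_def lap_diff[symmetric] by (rule abs_lap_le) (rule P)
      have "\<epsilon> * l = \<sigma>" using \<epsilon> by (simp add: l_def)
      then have "\<epsilon> * (u (Suc m) i - heat \<omega> r \<sigma> (u m) i)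
         = \<sigma> * (u (Suc m) i - meanV \<omega> r (u (Suc m)) + \<beta> (Suc m) i - meanV \<omega> r (\<beta> (Suc m)))"
        using arg_cong[OF step[of m i], of "\<lambda>x. \<epsilon> * x"]
        by (simp add: right_diff_distrib distrib_left mult.assoc[symmetric])
      then have "\<epsilon> * (u (Suc m) i - u m i) - \<sigma> * flow_rhs \<omega> r \<epsilon> (u (Suc m)) (\<beta> (Suc m)) i
        = \<epsilon> * ((heat \<omega> r \<sigma> (u m) i - (u m i - \<sigma> * lap \<omega> r (u m) i))
               + \<sigma> * (lap \<omega> r (u (Suc m)) i - lap \<omega> r (u m) i))"
        by (simp add: flow_rhs_def algebra_simps)
      also have "\<bar>\<dots>\<bar> \<le> \<epsilon> * (D * \<sigma>\<^sup>2 + \<sigma> * (L * (P * \<sigma>)))"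
        unfolding abs_mult using heat2[of m i] lap \<sigma> \<epsilon>
        by (intro mult_mono order_trans[OF abs_triangle_ineq] add_mono) (auto simp: abs_mult)
      finally show ?thesis
        by (simp add: Q_def power2_eq_square algebra_simps)
    qed
    then show ?thesis
      using u01 M P by blast
  qed
  show ?thesis
  proof (intro exI[of _ K] conjI allI impI)
    show "0 \<le> K"
      using nn by (simp add: K_def)
    fix \<sigma> u \<beta> m i
    assume "0 < \<sigma> \<and> \<sigma> < \<epsilon> \<and> semi_iter \<omega> r \<epsilon> \<sigma> u \<beta> \<and> u 0 = u0"
    then have \<sigma>: "0 < \<sigma>" and *: "(0 \<le> u m i \<and> u m i \<le> 1) \<and> \<bar>\<beta> (Suc m) i\<bar> \<le> M \<and>
       \<bar>u (Suc m) i - u m i\<bar> \<le> P * \<sigma> \<and>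
       \<bar>\<epsilon> * (u (Suc m) i - u m i) - \<sigma> * flow_rhs \<omega> r \<epsilon> (u (Suc m)) (\<beta> (Suc m)) i\<bar> \<le> Q * \<sigma>\<^sup>2"
      using main by auto
    have "M \<le> K" "P * \<sigma> \<le> K * \<sigma>" "Q * \<sigma>\<^sup>2 \<le> K * \<sigma>\<^sup>2"
      using nn \<sigma> by (auto simp: K_def intro!: mult_right_mono)
    with * show "0 \<le> u m i" "u m i \<le> 1" "\<bar>\<beta> (Suc m) i\<bar> \<le> K" "\<bar>u (Suc m) i - u m i\<bar> \<le> K * \<sigma>"
      "\<bar>\<epsilon> * (u (Suc m) i - u m i) - \<sigma> * flow_rhs \<omega> r \<epsilon> (u (Suc m)) (\<beta> (Suc m)) i\<bar> \<le> K * \<sigma>\<^sup>2"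
      by linarith+
  qed
qed

section \<open>Weak compactness and the Banach--Saks property\<close>

text \<open>An e/4 argument for the Cauchy property, so no candidate limit has to be named. It
  carries convergence from simpler to general integrable test functions and from rational to real
  times.\<close>

lemma convergent_uniform_approx:
  fixes y :: "nat \<Rightarrow> 'a::complete_space"
  assumes "\<And>e. 0 < e \<Longrightarrow> \<exists>x. convergent x \<and> (\<forall>\<^sub>F n in sequentially. dist (y n) (x n) \<le> e)"
  shows "convergent y"
proof (rule Cauchy_convergent, rule metric_CauchyI)
  fix e :: real assume e: "0 < e"
  obtain x where x: "convergent x" "\<forall>\<^sub>F n in sequentially. dist (y n) (x n) \<le> e / 4"
    using assms[of "e / 4"] e by auto
  obtain N1 where N1: "\<And>n. N1 \<le> n \<Longrightarrow> dist (y n) (x n) \<le> e / 4"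
    using x(2) by (auto simp: eventually_sequentially)
  obtain N2 where N2: "\<And>m n. N2 \<le> m \<Longrightarrow> N2 \<le> n \<Longrightarrow> dist (x m) (x n) < e / 4"
    using metric_CauchyD[OF convergent_Cauchy[OF x(1)], of "e / 4"] e by auto
  have "dist (y m) (y n) < e" if "max N1 N2 \<le> m" "max N1 N2 \<le> n" for m n
    using N1[of m] N1[of n] N2[of m n] that e
      dist_triangle[of "y m" "y n" "x m"] dist_triangle[of "x m" "y n" "x n"]
    by (auto simp: dist_commute)
  then show "\<exists>M. \<forall>m\<ge>M. \<forall>n\<ge>M. dist (y m) (y n) < e"
    by blast
qed

section \<open>Weak convergence of uniformly bounded sequences\<close>

lemma integrable_bounded_mult:
  fixes f g :: "'a \<Rightarrow> real"
  assumes [measurable]: "f \<in> borel_measurable M" and f: "\<And>x. \<bar>f x\<bar> \<le> C" and g: "integrable M g"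
  shows "integrable M (\<lambda>x. f x * g x)"
proof (rule Bochner_Integration.integrable_bound)
  show "integrable M (\<lambda>x. C * g x)" using g by simp
  show "AE x in M. norm (f x * g x) \<le> norm (C * g x)"
    using f by (auto simp: abs_mult intro!: mult_right_mono order_trans[OF f abs_ge_self])
qed (use g in measurable)

lemma abs_integral_bounded_mult_le:
  fixes f g :: "'a \<Rightarrow> real"
  assumes f: "f \<in> borel_measurable M" "\<And>x. \<bar>f x\<bar> \<le> C" and g: "integrable M g"
  shows "\<bar>\<integral>x. f x * g x \<partial>M\<bar> \<le> C * (\<integral>x. \<bar>g x\<bar> \<partial>M)"
proof -
  have "\<bar>\<integral>x. f x * g x \<partial>M\<bar> \<le> (\<integral>x. \<bar>f x * g x\<bar> \<partial>M)"
    by simp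
  also have "\<dots> \<le> (\<integral>x. C * \<bar>g x\<bar> \<partial>M)"
    using f g by (intro integral_mono integrable_abs integrable_bounded_mult[of f M C g] integrable_mult_right)
      (auto simp: abs_mult intro!: mult_right_mono)
  finally show ?thesis by simp
qed

text \<open>The uniform bound C makes the functionals on g equi-Lipschitz in L1, so the set of g
  with convergent integrals is closed under L1 limits. Dynkin's argument then reaches all measurable
  sets, and approximation by simple functions reaches all integrable g.\<close>

lemma weak_convergence_from_pi_system:
  fixes b :: "nat \<Rightarrow> 'a \<Rightarrow> real"
  assumes "finite_measure M" and G: "Int_stable G" "G \<subseteq> Pow (space M)" "space M \<in> G"
    and sets: "sets M = sigma_sets (space M) G"
    and b: "\<And>n. b n \<in> borel_measurable M" "\<And>n x. \<bar>b n x\<bar> \<le> C"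
    and conv: "\<And>A. A \<in> G \<Longrightarrow> convergent (\<lambda>n. \<integral>x. b n x * indicator A x \<partial>M)"
    and g: "integrable M g"
  shows "convergent (\<lambda>n. \<integral>x. b n x * g x \<partial>M)"
proof -
  interpret finite_measure M by fact
  let ?P = "\<lambda>g. convergent (\<lambda>n. \<integral>x. b n x * g x \<partial>M)"
  have C: "0 \<le> C"
    using b(2)[of undefined undefined] by linarith
  \<comment> \<open>Dominated convergence brings \<open>s k\<close> close to f in L1; the bound on
    \<open>b n\<close> makes the resulting error in the integrals uniform in n.\<close>
  have P_lim: "?P f" if int: "\<And>k. integrable M (s k)" and P: "\<And>k. ?P (s k)"
    and s: "\<And>x. x \<in> space M \<Longrightarrow> (\<lambda>k. s k x) \<longlonglongrightarrow> f x"
    and w: "integrable M w" "\<And>k x. x \<in> space M \<Longrightarrow> \<bar>s k x - f x\<bar> \<le> w x"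
    and f: "integrable M f" for f w :: "'a \<Rightarrow> real" and s
  proof (rule convergent_uniform_approx)
    fix e :: real assume e: "0 < e"
    have "(\<lambda>k. \<integral>x. \<bar>s k x - f x\<bar> \<partial>M) \<longlonglongrightarrow> (\<integral>x. 0 \<partial>M)"
    proof (rule integral_dominated_convergence[where w=w])
      show "AE x in M. (\<lambda>k. \<bar>s k x - f x\<bar>) \<longlonglongrightarrow> 0"
        using s by (intro AE_I2 tendsto_rabs_zero) (simp add: LIM_zero_iff)
    qed (use w int f in auto)
    then have "\<forall>\<^sub>F k in sequentially. (\<integral>x. \<bar>s k x - f x\<bar> \<partial>M) < e / (C + 1)"
      using e C by (intro order_tendstoD(2)) auto
    then obtain k where k: "(\<integral>x. \<bar>s k x - f x\<bar> \<partial>M) < e / (C + 1)"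
      by (auto simp: eventually_sequentially)
    have "\<bar>(\<integral>x. b n x * f x \<partial>M) - (\<integral>x. b n x * s k x \<partial>M)\<bar> \<le> e" for n
    proof -
      have "(\<integral>x. b n x * f x \<partial>M) - (\<integral>x. b n x * s k x \<partial>M) = (\<integral>x. b n x * (f x - s k x) \<partial>M)"
        using integrable_bounded_mult[OF b(1) b(2) f, of n] integrable_bounded_mult[OF b(1) b(2) int, of n k]
        by (simp add: right_diff_distrib)
      also have "\<bar>\<dots>\<bar> \<le> C * (\<integral>x. \<bar>f x - s k x\<bar> \<partial>M)"
        using b f int by (intro abs_integral_bounded_mult_le) auto
      also have "\<dots> \<le> (C + 1) * (\<integral>x. \<bar>s k x - f x\<bar> \<partial>M)"
        by (subst abs_minus_commute) (intro mult_right_mono integral_nonneg_AE, auto)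
      also have "\<dots> \<le> e"
        using k C by (simp add: pos_less_divide_eq mult.commute)
      finally show ?thesis .
    qed
    then show "\<exists>y. convergent y \<and> (\<forall>\<^sub>F n in sequentially. dist (\<integral>x. b n x * f x \<partial>M) (y n) \<le> e)"
      using P[of k] by (intro exI[of _ "\<lambda>n. \<integral>x. b n x * s k x \<partial>M"]) (auto simp: dist_real_def)
  qed
  have int_ind: "integrable M (indicator A :: 'a \<Rightarrow> real)" if "A \<in> sets M" for A
    using that by (simp add: emeasure_finite less_top[symmetric])
  have int_bind: "integrable M (\<lambda>x. b n x * indicator A x)" if "A \<in> sets M" for n A
    by (rule integrable_bounded_mult[OF b int_ind[OF that]])
  have ind: "?P (indicator A)" if "A \<in> sets M" for A
    using G(1,2) that[unfolded sets]
  proof (induction A rule: sigma_sets_induct_disjoint)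
    case (compl A)
    then have A: "A \<in> sets M" by (simp add: sets)
    have "(\<integral>x. b n x * indicator (space M - A) x \<partial>M)
      = (\<integral>x. b n x * indicator (space M) x \<partial>M) - (\<integral>x. b n x * indicator A x \<partial>M)" for n
      unfolding Bochner_Integration.integral_diff[OF int_bind[OF sets.top] int_bind[OF A], symmetric]
      by (intro Bochner_Integration.integral_cong) (auto simp: indicator_def)
    then show ?case
      using convergent_diff[OF conv[OF G(3)] compl.IH] by simp
  next
    \<comment> \<open>By disjointness the partial sums are indicators themselves, so the constant 1
      dominates; it is integrable because the measure is finite.\<close>
    case (union A)
    then have A: "A i \<in> sets M" for i by (auto simp: sets)
    show ?case
    proof (rule P_lim[where s = "\<lambda>k x. \<Sum>i<k. indicator (A i) x" and w = "\<lambda>_. 1"])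
      fix k
      show "integrable M (\<lambda>x. \<Sum>i<k. indicator (A i) x :: real)"
        by (intro Bochner_Integration.integrable_sum int_ind A)
      have "(\<integral>x. b n x * (\<Sum>i<k. indicator (A i) x) \<partial>M) = (\<Sum>i<k. \<integral>x. b n x * indicator (A i) x \<partial>M)" for n
        unfolding sum_distrib_left by (intro Bochner_Integration.integral_sum int_bind A)
      then show "?P (\<lambda>x. \<Sum>i<k. indicator (A i) x)"
        using union.IH by (simp add: convergent_sum)
      fix x
      have "(\<Sum>i<k. indicator (A i) x) = (indicator (\<Union>i<k. A i) x :: real)"
        using union.hyps by (intro indicator_UN_disjoint[symmetric]) (auto simp: disjoint_family_on_def)
      then show "\<bar>(\<Sum>i<k. indicator (A i) x) - indicator (\<Union>i. A i) x\<bar> \<le> (1::real)"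
        by (auto simp: indicator_def)
    next
      fix x
      have "(\<lambda>k. indicator (\<Union>i<k. A i) x :: real) \<longlonglongrightarrow> indicator (\<Union>i. A i) x"
        by (rule LIMSEQ_indicator_UN)
      moreover have "(\<Sum>i<k. indicator (A i) x) = (indicator (\<Union>i<k. A i) x :: real)" for k
        using union.hyps by (intro indicator_UN_disjoint[symmetric]) (auto simp: disjoint_family_on_def)
      ultimately show "(\<lambda>k. \<Sum>i<k. indicator (A i) x :: real) \<longlonglongrightarrow> indicator (\<Union>i. A i) x"
        by simp
    qed (use A in \<open>auto intro!: int_ind\<close>)
  qed (auto intro: conv convergent_const)
  from g show ?thesis
  proof induction
    case (base A c)
    have "(\<integral>x. b n x * (indicator A x *\<^sub>R c) \<partial>M) = (\<integral>x. b n x * indicator A x \<partial>M) * c" for n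
      by (simp add: mult.assoc[symmetric])
    then show ?case
      using convergent_mult[OF ind[OF base(1)] convergent_const[of c]] by simp
  next
    case (add f g)
    have "(\<integral>x. b n x * (f x + g x) \<partial>M) = (\<integral>x. b n x * f x \<partial>M) + (\<integral>x. b n x * g x \<partial>M)" for n
      using integrable_bounded_mult[OF b add(1)] integrable_bounded_mult[OF b add(2)] by (simp add: distrib_left)
    then show ?case
      using convergent_add[OF add(3,4)] by simp
  next
    case (lim f s)
    show ?case
    proof (rule P_lim[OF lim(1,5,2)])
      \<comment> \<open>The approximants of the induction satisfy |s k| \<le> 2 |f|, hence the
        factor 3.\<close>
      show "integrable M (\<lambda>x. 3 * \<bar>f x\<bar>)" using lim by simp
      show "\<bar>s k x - f x\<bar> \<le> 3 * \<bar>f x\<bar>" if "x \<in> space M" for k x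
        using lim(3)[OF that, of k] by (auto simp: abs_if split: if_splits)
    qed (use lim in auto)
  qed
qed

text \<open>Finite intersections of a countable base: countable for diagonal extraction,
  intersection-stable for Dynkin's argument. The empty family contributes the whole space.\<close>

lemma borel_countable_pi_system:
  obtains G :: "'a::second_countable_topology set set"
  where "countable G" "Int_stable G" "UNIV \<in> G" "sets borel = sigma_sets UNIV G"
proof -
  obtain B :: "'a set set" where B: "countable B" "topological_basis B"
    using ex_countable_basis by blast
  define G where "G = Inter ` {F. finite F \<and> F \<subseteq> B}"
  have op: "open A" if "A \<in> G" for A
    using that topological_basis_open[OF B(2)] by (auto simp: G_def intro!: open_Inter)
  show ?thesis
  proof
    show "countable G"
      unfolding G_def using countable_Collect_finite_subset[OF B(1)] by simp
    show "Int_stable G"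
    proof (rule Int_stableI)
      fix X Y assume "X \<in> G" "Y \<in> G"
      then obtain E F where "finite E" "E \<subseteq> B" "X = \<Inter>E" "finite F" "F \<subseteq> B" "Y = \<Inter>F"
        by (auto simp: G_def)
      then show "X \<inter> Y \<in> G"
        unfolding G_def by (intro image_eqI[of _ _ "E \<union> F"]) auto
    qed
    show "UNIV \<in> G"
      unfolding G_def by (intro image_eqI[of _ _ "{}"]) auto
    have "B \<subseteq> G"
      unfolding G_def by (auto intro!: image_eqI[of _ _ "{_}"])
    then have "sets borel \<subseteq> sigma_sets UNIV G"
      unfolding borel_eq_countable_basis[OF B] by (simp add: sets_measure_of sigma_sets_mono')
    moreover have "sigma_sets UNIV G \<subseteq> sets borel"
    proof -
      have "G \<subseteq> sets borel"
        using op by auto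
      from sets.sigma_sets_subset[OF this] show ?thesis
        by simp
    qed
    ultimately show "sets borel = sigma_sets UNIV G" ..
  qed
qed

text \<open>Diagonal extraction over the countably many pairs of a component and a generating set.
  Only convergence of the integrals is claimed; the limit function is found later from arithmetic
  means.\<close>

lemma bounded_weakly_convergent_subsequence:
  fixes M :: "'a::second_countable_topology measure" and b :: "nat \<Rightarrow> 'i::countable \<Rightarrow> 'a \<Rightarrow> real"
  assumes "finite_measure M" and M: "sets M = sets borel"
    and b: "\<And>n i. b n i \<in> borel_measurable M" "\<And>n i x. \<bar>b n i x\<bar> \<le> C"
  obtains s where "strict_mono s"
    "\<forall>i g. integrable M g \<longrightarrow> convergent (\<lambda>n. \<integral>x. b (s n) i x * g x \<partial>M)"
proof -
  interpret finite_measure M by fact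
  have sp: "space M = UNIV"
    using sets_eq_imp_space_eq[OF M] by simp
  obtain G :: "'a set set" where G: "countable G" "Int_stable G" "UNIV \<in> G" "sets borel = sigma_sets UNIV G"
    by (rule borel_countable_pi_system)
  let ?f = "\<lambda>n p. \<integral>x. b n (fst p) x * indicator (snd p) x \<partial>M"
  have C: "0 \<le> C"
    using b(2)[of undefined undefined undefined] by linarith
  have bound: "norm (?f n p) \<le> C * measure M UNIV" if "p \<in> UNIV \<times> G" for n p
  proof -
    have [measurable]: "snd p \<in> sets M"
      unfolding M G(4) using that by (intro sigma_sets.Basic) auto
    have "\<bar>?f n p\<bar> \<le> C * (\<integral>x. \<bar>indicator (snd p) x\<bar> \<partial>M)"
      using b by (intro abs_integral_bounded_mult_le) (auto simp: emeasure_finite less_top[symmetric])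
    also have "\<dots> = C * measure M (snd p)"
      by simp
    also have "\<dots> \<le> C * measure M UNIV"
      using C M by (intro mult_left_mono finite_measure_mono) auto
    finally show ?thesis by simp
  qed
  have cnt: "countable (UNIV \<times> G :: ('i \<times> 'a set) set)"
    using G(1) by (intro countable_SIGMA) auto
  show ?thesis
  proof (rule function_convergent_subsequence[where f = ?f, OF cnt bound])
    fix s :: "nat \<Rightarrow> nat"
    assume s: "strict_mono s" "\<And>p. p \<in> UNIV \<times> G \<Longrightarrow> \<exists>l. (\<lambda>n. ?f (s n) p) \<longlonglongrightarrow> l"
    show ?thesis
    proof (rule that[OF s(1)], intro allI impI)
      fix i and g :: "'a \<Rightarrow> real" assume g: "integrable M g"
      have "convergent (\<lambda>n. \<integral>x. b (s n) i x * indicator A x \<partial>M)" if "A \<in> G" for A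
        using s(2)[of "(i, A)"] that by (simp add: convergent_def)
      then show "convergent (\<lambda>n. \<integral>x. b (s n) i x * g x \<partial>M)"
        using G(3,4) M by (intro weak_convergence_from_pi_system[OF assms(1) G(2) _ _ _ b _ g])
          (simp_all add: sp)
    qed
  qed
qed

text \<open>G will be the matrix of inner products of a weakly convergent sequence. Its row limits
  are bounded and so accumulate at some a, morally the squared norm of the weak limit; thinning out
  brings all entries above the diagonal close to a.\<close>

lemma almost_constant_subsequence:
  fixes G :: "nat \<Rightarrow> nat \<Rightarrow> real"
  assumes bound: "\<And>n m. \<bar>G n m\<bar> \<le> C" and conv: "\<And>n. convergent (G n)"
  obtains s a where "strict_mono s" "\<bar>a\<bar> \<le> C" "\<forall>j k. j < k \<longrightarrow> \<bar>G (s j) (s k) - a\<bar> \<le> (1 / 2) ^ j"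
proof -
  define l where "l n = lim (G n)" for n
  have l: "G n \<longlonglongrightarrow> l n" for n
    unfolding l_def using conv by (simp add: convergent_LIMSEQ_iff)
  have l_le: "\<bar>l n\<bar> \<le> C" for n
    by (rule LIMSEQ_le_const2[OF tendsto_rabs[OF l[of n]]]) (use bound in auto)
  then have "bounded (range l)"
    by (auto simp: bounded_iff)
  from bounded_imp_convergent_subsequence[OF this]
  obtain a r where r: "strict_mono (r :: nat \<Rightarrow> nat)" and lr: "(l \<circ> r) \<longlonglongrightarrow> a"
    by blast
  have a: "\<bar>a\<bar> \<le> C"
    by (rule LIMSEQ_le_const2[OF tendsto_rabs[OF lr]]) (use l_le in auto)
  let ?e = "\<lambda>j. (1 / 2) ^ j / 2 :: real"
  have near_a: "\<exists>n0. \<forall>n\<ge>n0. \<bar>l (r n) - a\<bar> \<le> ?e j" for j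
    using LIMSEQ_D[OF lr, of "?e j"] by (auto intro: less_imp_le)
  have near_l: "\<exists>m0. \<forall>m\<ge>m0. \<bar>G (r n) (r m) - l (r n)\<bar> \<le> ?e j" for n j
    using LIMSEQ_D[OF LIMSEQ_subseq_LIMSEQ[OF l[of "r n"] r], of "?e j"] by (auto intro: less_imp_le)
  \<comment> \<open>\<open>f (Suc j)\<close> lies beyond two thresholds: its own row limit is close
    to a, and from there on row \<open>f j\<close> stays close to its limit. The error of an entry
    with j < k is thus governed by j alone.\<close>
  have "\<exists>f. \<forall>j. \<bar>l (r (f j)) - a\<bar> \<le> ?e j \<and>
          (f j < f (Suc j) \<and> (\<forall>m\<ge>f (Suc j). \<bar>G (r (f j)) (r m) - l (r (f j))\<bar> \<le> ?e j))"
  proof (rule dependent_nat_choice)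
    show "\<exists>n. \<bar>l (r n) - a\<bar> \<le> ?e 0"
      using near_a[of 0] by auto
    fix n j
    obtain n0 where n0: "\<forall>n\<ge>n0. \<bar>l (r n) - a\<bar> \<le> ?e (Suc j)"
      using near_a by blast
    obtain m0 where m0: "\<forall>m\<ge>m0. \<bar>G (r n) (r m) - l (r n)\<bar> \<le> ?e j"
      using near_l by blast
    show "\<exists>y. \<bar>l (r y) - a\<bar> \<le> ?e (Suc j) \<and> (n < y \<and> (\<forall>m\<ge>y. \<bar>G (r n) (r m) - l (r n)\<bar> \<le> ?e j))"
      using n0 m0 by (intro exI[of _ "max (Suc n) (max n0 m0)"]) auto
  qed
  then obtain f where f: "\<And>j. \<bar>l (r (f j)) - a\<bar> \<le> ?e j" "\<And>j. f j < f (Suc j)"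
    "\<And>j m. f (Suc j) \<le> m \<Longrightarrow> \<bar>G (r (f j)) (r m) - l (r (f j))\<bar> \<le> ?e j"
    by blast
  have fm: "strict_mono f"
    using f(2) by (simp add: strict_mono_Suc_iff)
  show ?thesis
  proof (rule that[of "r \<circ> f" a])
    show "strict_mono (r \<circ> f)"
      using r fm by (rule strict_mono_o)
    show "\<bar>a\<bar> \<le> C" by (rule a)
    show "\<forall>j k. j < k \<longrightarrow> \<bar>G ((r \<circ> f) j) ((r \<circ> f) k) - a\<bar> \<le> (1 / 2) ^ j"
    proof (intro allI impI)
      fix j k :: nat assume "j < k"
      then have "f (Suc j) \<le> f k"
        using fm by (simp add: strict_mono_less_eq Suc_le_eq)
      then show "\<bar>G ((r \<circ> f) j) ((r \<circ> f) k) - a\<bar> \<le> (1 / 2) ^ j"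
        using f(1)[of j] f(3)[of j "f k"] unfolding o_def by linarith
    qed
  qed
qed

text \<open>Each off-diagonal error is charged to the smaller index, giving geometric sums along
  rows and columns, and a row meets the diagonal at most once. The total error is O(N + N') against
  N N' entries.\<close>

lemma double_mean_bound:
  fixes G :: "nat \<Rightarrow> nat \<Rightarrow> real"
  assumes sym: "\<And>j k. G j k = G k j" and off: "\<And>j k. j < k \<Longrightarrow> \<bar>G j k - a\<bar> \<le> (1 / 2) ^ j"
    and diag: "\<And>j. \<bar>G j j - a\<bar> \<le> D" and N: "0 < N" "0 < N'"
  shows "\<bar>(\<Sum>j<N. \<Sum>k<N'. G j k) / (real N * real N') - a\<bar> \<le> (2 + D) * (1 / real N + 1 / real N')"
proof -
  have D: "0 \<le> D"
    using diag[of 0] by linarith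
  have half: "(\<Sum>j<n. (1 / 2) ^ j) \<le> (2 :: real)" for n
    by (simp add: sum_gp_strict)
  have pt: "\<bar>G j k - a\<bar> \<le> (1 / 2) ^ j + (1 / 2) ^ k + (if k = j then D else 0)" for j k
  proof (cases j k rule: linorder_cases)
    case less
    then show ?thesis
      by (intro order_trans[OF off[OF less]]) simp
  next
    case equal
    then show ?thesis
      using diag[of j] by (auto intro: order_trans[of _ D])
  next
    case greater
    then show ?thesis
      unfolding sym[of j k] by (intro order_trans[OF off[OF greater]]) simp
  qed
  have "(\<Sum>j<N. \<Sum>k<N'. G j k) - a * (real N * real N') = (\<Sum>j<N. \<Sum>k<N'. G j k - a)"
    by (simp add: sum_subtractf)
  also have "\<bar>\<dots>\<bar> \<le> (\<Sum>j<N. \<Sum>k<N'. (1 / 2) ^ j + (1 / 2) ^ k + (if k = j then D else 0))"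
    by (intro order_trans[OF sum_abs] sum_mono pt)
  also have "\<dots> \<le> (\<Sum>j<N. real N' * (1 / 2) ^ j + 2 + D)"
  proof (rule sum_mono)
    fix j
    show "(\<Sum>k<N'. (1 / 2) ^ j + (1 / 2) ^ k + (if k = j then D else 0)) \<le> real N' * (1 / 2) ^ j + 2 + D"
      using half[of N'] D by (auto simp: sum.distrib)
  qed
  also have "\<dots> = real N' * (\<Sum>j<N. (1 / 2) ^ j) + real N * (2 + D)"
    by (simp add: sum.distrib sum_distrib_left algebra_simps)
  also have "\<dots> \<le> real N' * (2 + D) + real N * (2 + D)"
    using half[of N] D by (intro add_right_mono mult_left_mono) auto
  finally have *: "\<bar>(\<Sum>j<N. \<Sum>k<N'. G j k) - a * (real N * real N')\<bar> \<le> (2 + D) * (real N + real N')"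
    by (simp add: algebra_simps)
  have "(\<Sum>j<N. \<Sum>k<N'. G j k) / (real N * real N') - a
      = ((\<Sum>j<N. \<Sum>k<N'. G j k) - a * (real N * real N')) / (real N * real N')"
    using N by (simp add: field_simps)
  also have "\<bar>\<dots>\<bar> \<le> (2 + D) * (real N + real N') / (real N * real N')"
    using * N by (simp add: abs_divide divide_right_mono)
  also have "\<dots> = (2 + D) * (1 / real N + 1 / real N')"
    using N by (simp add: field_simps)
  finally show ?thesis .
qed

lemma arithmetic_means_tendsto:
  fixes x :: "nat \<Rightarrow> real"
  assumes "x \<longlonglongrightarrow> L"
  shows "(\<lambda>N. (\<Sum>n<N. x n) / real N) \<longlonglongrightarrow> L"
proof (rule LIMSEQ_I)
  fix e :: real assume e: "0 < e"
  obtain n0 where n0: "\<And>n. n0 \<le> n \<Longrightarrow> \<bar>x n - L\<bar> < e / 2"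
    using LIMSEQ_D[OF assms, of "e / 2"] e by auto
  define A where "A = (\<Sum>n<n0. \<bar>x n - L\<bar>)"
  obtain N0 :: nat where N0: "2 * A / e < real N0"
    using reals_Archimedean2 by blast
  show "\<exists>N1. \<forall>N\<ge>N1. norm ((\<Sum>n<N. x n) / real N - L) < e"
  proof (intro exI allI impI)
    fix N assume N: "Suc (N0 + n0) \<le> N"
    have "\<bar>(\<Sum>n<N. x n) - real N * L\<bar> \<le> (\<Sum>n<N. \<bar>x n - L\<bar>)"
      using sum_abs[of "\<lambda>n. x n - L" "{..<N}"] by (simp add: sum_subtractf)
    also have "\<dots> = A + (\<Sum>n=n0..<N. \<bar>x n - L\<bar>)"
      unfolding A_def using N by (intro sum.atLeastLessThan_concat[of 0 n0 N, symmetric, unfolded atLeast0LessThan]) auto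
    also have "\<dots> \<le> A + (\<Sum>n=n0..<N. e / 2)"
      by (intro add_left_mono sum_mono less_imp_le[OF n0]) auto
    also have "\<dots> \<le> A + real N * (e / 2)"
      using e by simp
    also have "\<dots> < real N * e"
    proof -
      have "2 * A < real N0 * e" using N0 e by (simp add: field_simps)
      also have "\<dots> \<le> real N * e" using N e by (intro mult_right_mono) auto
      finally show ?thesis by (simp add: field_simps)
    qed
    finally have "\<bar>(\<Sum>n<N. x n) - real N * L\<bar> / real N < e"
      using N by (simp add: field_simps)
    moreover have "(\<Sum>n<N. x n) / real N - L = ((\<Sum>n<N. x n) - real N * L) / real N"
      using N by (simp add: field_simps)
    ultimately show "norm ((\<Sum>n<N. x n) / real N - L) < e"
      by (simp add: abs_divide)
  qed
qed

text \<open>Banach--Saks: along a subsequence on which all inner products are nearly constant, the squared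
  \<open>L\<^sup>2\<close> distance of the means of lengths \<open>N\<close> and \<open>N'\<close> is of order \<open>1 / N + 1 / N'\<close>.\<close>
lemma banach_saks_subsequence:
  fixes M :: "'a measure" and b :: "nat \<Rightarrow> 'i::finite \<Rightarrow> 'a \<Rightarrow> real"
  assumes "finite_measure M"
    and b: "\<And>n i. b n i \<in> borel_measurable M" "\<And>n i x. \<bar>b n i x\<bar> \<le> C"
    and conv: "\<And>n i. convergent (\<lambda>m. \<integral>x. b n i x * b m i x \<partial>M)"
  obtains s N where "strict_mono s" "strict_mono N" "0 < N 0"
    "AE x in M. \<forall>i. convergent (\<lambda>k. (\<Sum>n<N k. b (s n) i x) / real (N k))"
proof -
  interpret finite_measure M by fact
  have C: "0 \<le> C"
    using b(2)[of undefined undefined undefined] by linarith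
  have int: "integrable M f" if "f \<in> borel_measurable M" "\<And>x. \<bar>f x\<bar> \<le> K" for f :: "'a \<Rightarrow> real" and K
    using that by (intro integrable_const_bound[of _ K]) auto
  have int_bb: "integrable M (\<lambda>x. b n i x * b m i x)" for n m i
    using b C by (intro int[of _ "C * C"]) (auto simp: abs_mult intro!: mult_mono)
  define G where "G n m = (\<Sum>i\<in>UNIV. \<integral>x. b n i x * b m i x \<partial>M)" for n m
  define C' where "C' = real CARD('i) * (C * C * measure M (space M))"
  have G_le: "\<bar>G n m\<bar> \<le> C'" for n m
  proof -
    have "\<bar>\<integral>x. b n i x * b m i x \<partial>M\<bar> \<le> C * C * measure M (space M)" for i
    proof -
      have "\<bar>\<integral>x. b n i x * b m i x \<partial>M\<bar> \<le> (\<integral>x. \<bar>b n i x * b m i x\<bar> \<partial>M)"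
        by simp
      also have "\<dots> \<le> (\<integral>x. C * C \<partial>M)"
        using b C by (intro integral_mono integrable_abs int_bb) (auto simp: abs_mult intro!: mult_mono)
      finally show ?thesis by (simp add: mult_ac)
    qed
    then show ?thesis
      unfolding G_def C'_def by (intro order_trans[OF sum_abs] sum_bounded_above) auto
  qed
  have "convergent (G n)" for n
    unfolding G_def by (intro convergent_sum conv)
  then obtain s a where s: "strict_mono s" and a: "\<bar>a\<bar> \<le> C'"
    and Ga: "\<forall>j k. j < k \<longrightarrow> \<bar>G (s j) (s k) - a\<bar> \<le> (1 / 2) ^ j"
    by (rule almost_constant_subsequence[where G = G, OF G_le])
  define D where "D = 2 * C'"
  have G_sym: "G n m = G m n" for n m
    by (simp add: G_def mult.commute)
  have G_diag: "\<bar>G (s j) (s j) - a\<bar> \<le> D" for j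
    using G_le[of "s j" "s j"] a by (auto simp: D_def abs_le_iff)
  have D: "0 \<le> D"
    using G_diag[of 0] by linarith
  define S where "S N i x = (\<Sum>n<N. b (s n) i x) / real N" for N i x
  have S_meas: "S N i \<in> borel_measurable M" for N i
    unfolding S_def using b(1) by measurable
  have S_le: "\<bar>S N i x\<bar> \<le> C" for N i x
  proof (cases "N = 0")
    case False
    have "\<bar>\<Sum>n<N. b (s n) i x\<bar> \<le> real N * C"
      using b(2) by (intro order_trans[OF sum_abs] order_trans[OF sum_bounded_above[of _ _ C]]) auto
    then show ?thesis
      using False by (simp add: S_def abs_divide divide_le_eq mult.commute)
  qed (use C in \<open>simp add: S_def\<close>)
  have int_SS: "integrable M (\<lambda>x. S N i x * S N' i x)" for N N' i
    using S_meas S_le C by (intro int[of _ "C * C"]) (auto simp: abs_mult intro!: mult_mono)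
  define Q where "Q N N' = (\<Sum>i\<in>UNIV. \<integral>x. S N i x * S N' i x \<partial>M)" for N N'
  have Q_eq: "Q N N' = (\<Sum>j<N. \<Sum>k<N'. G (s j) (s k)) / (real N * real N')" for N N'
  proof -
    have "(\<integral>x. S N i x * S N' i x \<partial>M)
        = (\<Sum>j<N. \<Sum>k<N'. \<integral>x. b (s j) i x * b (s k) i x \<partial>M) / (real N * real N')" for i
    proof -
      have "(\<integral>x. S N i x * S N' i x \<partial>M)
          = (\<integral>x. (\<Sum>j<N. \<Sum>k<N'. b (s j) i x * b (s k) i x) / (real N * real N') \<partial>M)"
        by (simp add: S_def sum_product)
      also have "\<dots> = (\<Sum>j<N. \<Sum>k<N'. \<integral>x. b (s j) i x * b (s k) i x \<partial>M) / (real N * real N')"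
        by (simp add: int_bb)
      finally show ?thesis .
    qed
    then have "Q N N' = (\<Sum>i\<in>UNIV. \<Sum>j<N. \<Sum>k<N'. \<integral>x. b (s j) i x * b (s k) i x \<partial>M) / (real N * real N')"
      by (simp add: Q_def sum_divide_distrib)
    also have "(\<Sum>i\<in>UNIV. \<Sum>j<N. \<Sum>k<N'. \<integral>x. b (s j) i x * b (s k) i x \<partial>M)
        = (\<Sum>j<N. \<Sum>k<N'. G (s j) (s k))"
      unfolding G_def by (subst sum.swap) (intro sum.cong refl sum.swap)
    finally show ?thesis .
  qed
  have Q_le: "\<bar>Q N N' - a\<bar> \<le> (2 + D) * (1 / real N + 1 / real N')" if "0 < N" "0 < N'" for N N'
    unfolding Q_eq using double_mean_bound[of "\<lambda>j k. G (s j) (s k)", OF G_sym Ga[rule_format] G_diag that] .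
  \<comment> \<open>Expanding the square gives \<open>Q N N + Q N' N' - 2 * Q N N'\<close>; the
    common value a cancels and only the errors from \<open>Q_le\<close> remain.\<close>
  have dist_le: "(\<Sum>i\<in>UNIV. \<integral>x. (S N i x - S N' i x)\<^sup>2 \<partial>M) \<le> 4 * (2 + D) * (1 / real N + 1 / real N')"
    if N: "0 < N" "0 < N'" for N N'
  proof -
    have "(\<integral>x. (S N i x - S N' i x)\<^sup>2 \<partial>M)
        = (\<integral>x. S N i x * S N i x \<partial>M) + (\<integral>x. S N' i x * S N' i x \<partial>M) - 2 * (\<integral>x. S N i x * S N' i x \<partial>M)" for i
    proof -
      have "(\<integral>x. (S N i x - S N' i x)\<^sup>2 \<partial>M)
        = (\<integral>x. S N i x * S N i x + S N' i x * S N' i x - 2 * (S N i x * S N' i x) \<partial>M)"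
        by (simp add: power2_eq_square algebra_simps)
      then show ?thesis
        using int_SS by simp
    qed
    then have "(\<Sum>i\<in>UNIV. \<integral>x. (S N i x - S N' i x)\<^sup>2 \<partial>M) = Q N N + Q N' N' - 2 * Q N N'"
      by (simp add: Q_def sum.distrib sum_subtractf sum_distrib_left)
    also have "\<dots> \<le> 2 * ((2 + D) * (1 / real N + 1 / real N'))
        + (2 + D) * (1 / real N + 1 / real N) + (2 + D) * (1 / real N' + 1 / real N')"
      using Q_le[OF N(1) N(1)] Q_le[OF N(2) N(2)] Q_le[OF N] by linarith
    also have "\<dots> = 4 * (2 + D) * (1 / real N + 1 / real N')"
      by (simp add: algebra_simps add_divide_distrib)
    finally show ?thesis .
  qed
  \<comment> \<open>With the components gathered in a Euclidean vector, one L1 subsequence serves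
    all of them. \<open>Suc\<close> avoids the empty mean.\<close>
  define V :: "nat \<Rightarrow> 'a \<Rightarrow> real ^ 'i" where "V n x = (\<chi> i. S (Suc n) i x)" for n x
  have V_meas [measurable]: "V n \<in> borel_measurable M" for n
    unfolding borel_measurable_euclidean_space[of "V n"] Basis_vec_def
    using S_meas by (auto simp: V_def inner_axis)
  have V_norm: "norm (V n x) \<le> real CARD('i) * C" for n x
    using S_le by (intro order_trans[OF norm_le_l1_cart] sum_bounded_above[THEN order_trans]) (auto simp: V_def)
  have V_int: "integrable M (V n)" for n
    using V_norm by (intro integrable_const_bound[of _ "real CARD('i) * C"]) auto
  have V_sq: "(norm (V n x - V m x))\<^sup>2 = (\<Sum>i\<in>UNIV. (S (Suc n) i x - S (Suc m) i x)\<^sup>2)" for n m x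
    by (simp add: norm_vec_def L2_set_def sum_nonneg V_def)
  have int_sq: "integrable M (\<lambda>x. (S N i x - S N' i x)\<^sup>2)" for N N' i
  proof -
    have "integrable M (\<lambda>x. S N i x * S N i x + S N' i x * S N' i x - 2 * (S N i x * S N' i x))"
      using int_SS by auto
    then show ?thesis
      by (simp add: power2_eq_square algebra_simps)
  qed
  have "\<exists>N. \<forall>n\<ge>N. \<forall>m\<ge>N. (\<integral>x. norm (V n x - V m x) \<partial>M) < e" if e: "0 < e" for e
  proof -
    define \<mu> where "\<mu> = measure M (space M)"
    \<comment> \<open>d is the parameter of \<open>amgm\<close> below, which takes the place of
      Cauchy-Schwarz in passing from L2 to L1: the constant d / 2 integrates to at most e / 2.
      \<open>\<mu> + 1\<close> avoids division by zero.\<close>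
    define d where "d = e / (\<mu> + 1)"
    have \<mu>: "0 \<le> \<mu>" by (simp add: \<mu>_def)
    have d: "0 < d" using e \<mu> by (simp add: d_def)
    obtain N :: nat where N: "8 * (2 + D) / (d * e) < real N"
      using reals_Archimedean2 by blast
    have N': "8 * (2 + D) * (1 / real (Suc N)) / d < e"
    proof -
      have "8 * (2 + D) < real N * (d * e)"
        using N d e by (simp add: pos_divide_less_eq)
      also have "\<dots> \<le> real (Suc N) * (d * e)"
        using d e by (intro mult_right_mono) auto
      finally have "8 * (2 + D) / (real (Suc N) * d) < e"
        using d by (simp add: pos_divide_less_eq mult_ac del: of_nat_Suc)
      then show ?thesis
        by (simp add: divide_divide_eq_left del: of_nat_Suc)
    qed
    have "(\<integral>x. norm (V n x - V m x) \<partial>M) < e" if nm: "N \<le> n" "N \<le> m" for n m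
    proof -
      have amgm: "y \<le> (1 / d) * y\<^sup>2 / 2 + d / 2" for y :: real
      proof -
        have "0 \<le> (y - d)\<^sup>2 / d" using d by simp
        also have "(y - d)\<^sup>2 / d = (1 / d) * y\<^sup>2 + d - 2 * y"
          using d by (simp add: power2_eq_square field_simps)
        finally show ?thesis by (simp add: field_simps)
      qed
      have int2: "integrable M (\<lambda>x. (norm (V n x - V m x))\<^sup>2)"
        unfolding V_sq by (intro Bochner_Integration.integrable_sum int_sq)
      have "(\<integral>x. norm (V n x - V m x) \<partial>M) \<le> (\<integral>x. (1 / d) * (norm (V n x - V m x))\<^sup>2 / 2 + d / 2 \<partial>M)"
        using int2 V_int by (intro integral_mono amgm) auto
      also have "\<dots> = (1 / d) * (\<integral>x. (norm (V n x - V m x))\<^sup>2 \<partial>M) / 2 + \<mu> * d / 2"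
        using int2 by (simp add: \<mu>_def)
      also have "(\<integral>x. (norm (V n x - V m x))\<^sup>2 \<partial>M) = (\<Sum>i\<in>UNIV. \<integral>x. (S (Suc n) i x - S (Suc m) i x)\<^sup>2 \<partial>M)"
        unfolding V_sq by (intro Bochner_Integration.integral_sum int_sq)
      also have "(1 / d) * \<dots> / 2 + \<mu> * d / 2
          \<le> (1 / d) * (4 * (2 + D) * (1 / real (Suc n) + 1 / real (Suc m))) / 2 + \<mu> * d / 2"
        using d by (intro add_right_mono divide_right_mono mult_left_mono dist_le) auto
      also have "\<dots> \<le> (1 / d) * (4 * (2 + D) * (1 / real (Suc N) + 1 / real (Suc N))) / 2 + \<mu> * d / 2"
        using d D nm by (intro add_right_mono divide_right_mono mult_left_mono add_mono) (auto simp: frac_le)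
      also have "\<dots> = (8 * (2 + D) * (1 / real (Suc N)) / d) / 2 + \<mu> * d / 2"
        by simp
      also have "\<dots> < e / 2 + \<mu> * d / 2"
        by (intro add_strict_right_mono divide_strict_right_mono N') simp
      also have "\<mu> * d \<le> e"
        using \<mu> e by (simp add: d_def field_simps)
      finally show ?thesis by simp
    qed
    then show ?thesis by blast
  qed
  then obtain r where r: "strict_mono r" and ae: "AE x in M. Cauchy (\<lambda>k. V (r k) x)"
    by (rule cauchy_L1_AE_cauchy_subseq[where s = V, OF V_int])
  show ?thesis
  proof (rule that[of s "\<lambda>k. Suc (r k)"])
    show "strict_mono (\<lambda>k. Suc (r k))"
      using r by (simp add: strict_mono_def)
    show "AE x in M. \<forall>i. convergent (\<lambda>k. (\<Sum>n<Suc (r k). b (s n) i x) / real (Suc (r k)))"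
      using ae
    proof eventually_elim
      case (elim x)
      then obtain l where "(\<lambda>k. V (r k) x) \<longlonglongrightarrow> l"
        by (auto simp: Cauchy_convergent_iff convergent_def)
      then have "(\<lambda>k. V (r k) x $ i) \<longlonglongrightarrow> l $ i" for i
        by (rule tendsto_vec_nth)
      then show ?case
        unfolding convergent_def V_def S_def by auto
    qed
  qed (use s in auto)
qed

text \<open>The means identify the weak limit: averaging keeps the limit of the integrals, and
  dominated convergence evaluates it with the almost-everywhere limit of the means.\<close>

theorem weak_and_mean_convergent_subsequence_finite:
  fixes M :: "'a::second_countable_topology measure" and b :: "nat \<Rightarrow> 'i::finite \<Rightarrow> 'a \<Rightarrow> real"
  assumes fin: "finite_measure M" and M: "sets M = sets borel"
    and b: "\<And>n i. b n i \<in> borel_measurable M" "\<And>n i x. \<bar>b n i x\<bar> \<le> C"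
  obtains s N \<gamma> where "strict_mono s" "strict_mono N"
    "\<forall>i. \<gamma> i \<in> borel_measurable M" "\<forall>i x. \<bar>\<gamma> i x\<bar> \<le> C"
    "AE x in M. \<forall>i. (\<lambda>k. (\<Sum>n<N k. b (s n) i x) / real (N k)) \<longlonglongrightarrow> \<gamma> i x"
    "\<forall>i g. integrable M g \<longrightarrow> (\<lambda>n. \<integral>x. b (s n) i x * g x \<partial>M) \<longlonglongrightarrow> (\<integral>x. \<gamma> i x * g x \<partial>M)"
proof -
  interpret finite_measure M by fact
  have C: "0 \<le> C"
    using b(2)[of undefined undefined undefined] by linarith
  have int: "integrable M f" if "f \<in> borel_measurable M" "\<And>x. \<bar>f x\<bar> \<le> K" for f :: "'a \<Rightarrow> real" and K
    using that by (intro integrable_const_bound[of _ K]) auto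
  obtain s1 where s1: "strict_mono s1"
    and weak: "\<forall>i g. integrable M g \<longrightarrow> convergent (\<lambda>n. \<integral>x. b (s1 n) i x * g x \<partial>M)"
    by (rule bounded_weakly_convergent_subsequence[where b = b, OF fin M b])
  \<comment> \<open>On a finite measure space the bounded functions \<open>b (s1 n) i\<close> are
    integrable, so they may serve as test functions themselves; every row of the inner-product
    matrix then converges.\<close>
  have conv: "convergent (\<lambda>m. \<integral>x. b (s1 n) i x * b (s1 m) i x \<partial>M)" for n i
  proof -
    have "convergent (\<lambda>m. \<integral>x. b (s1 m) i x * b (s1 n) i x \<partial>M)"
      by (rule weak[rule_format, OF int[OF b]])
    then show ?thesis
      by (simp add: mult.commute)
  qed
  obtain s2 N where s2: "strict_mono s2" and N: "strict_mono N" "0 < N 0"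
    and means: "AE x in M. \<forall>i. convergent (\<lambda>k. (\<Sum>n<N k. b (s1 (s2 n)) i x) / real (N k))"
    by (rule banach_saks_subsequence[where b = "\<lambda>n. b (s1 n)", OF fin b conv])
  have N_pos: "0 < N k" for k
    using N strict_mono_leD[OF N(1), of 0 k] by linarith
  define S where "S k i x = (\<Sum>n<N k. b (s1 (s2 n)) i x) / real (N k)" for k i x
  have S_meas: "S k i \<in> borel_measurable M" for k i
    unfolding S_def using b(1) by measurable
  have S_le: "\<bar>S k i x\<bar> \<le> C" for k i x
  proof -
    have "\<bar>\<Sum>n<N k. b (s1 (s2 n)) i x\<bar> \<le> real (N k) * C"
      using b(2) by (intro order_trans[OF sum_abs] order_trans[OF sum_bounded_above[of _ _ C]]) auto
    then show ?thesis
      using N_pos[of k] by (simp add: S_def abs_divide divide_le_eq mult.commute)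
  qed
  \<comment> \<open>The cut-off makes the bound C hold everywhere, also on the null set where the
    means diverge and \<open>lim\<close> is unspecified.\<close>
  define \<gamma> where "\<gamma> i x = (let l = lim (\<lambda>k. S k i x) in if \<bar>l\<bar> \<le> C then l else 0)" for i x
  have \<gamma>_meas: "\<gamma> i \<in> borel_measurable M" for i
    unfolding \<gamma>_def Let_def using S_meas by measurable
  have \<gamma>_le: "\<bar>\<gamma> i x\<bar> \<le> C" for i x
    using C by (simp add: \<gamma>_def Let_def)
  have lim_S: "AE x in M. \<forall>i. (\<lambda>k. S k i x) \<longlonglongrightarrow> \<gamma> i x"
    using means
  proof eventually_elim
    case (elim x)
    show ?case
    proof
      fix i
      have lim: "(\<lambda>k. S k i x) \<longlonglongrightarrow> lim (\<lambda>k. S k i x)"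
        using elim by (simp add: S_def convergent_LIMSEQ_iff)
      moreover have "\<bar>lim (\<lambda>k. S k i x)\<bar> \<le> C"
        by (rule LIMSEQ_le_const2[OF tendsto_rabs[OF lim]]) (use S_le in auto)
      ultimately show "(\<lambda>k. S k i x) \<longlonglongrightarrow> \<gamma> i x"
        by (simp add: \<gamma>_def)
    qed
  qed
  have "(\<lambda>n. \<integral>x. b (s1 (s2 n)) i x * g x \<partial>M) \<longlonglongrightarrow> (\<integral>x. \<gamma> i x * g x \<partial>M)"
    if g: "integrable M g" for i g
  proof -
    have int_b: "integrable M (\<lambda>x. b n i x * g x)" for n
      by (rule integrable_bounded_mult[OF b g])
    obtain l where "(\<lambda>n. \<integral>x. b (s1 n) i x * g x \<partial>M) \<longlonglongrightarrow> l"
      using weak g by (auto simp: convergent_def)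
    from LIMSEQ_subseq_LIMSEQ[OF this s2]
    have l: "(\<lambda>n. \<integral>x. b (s1 (s2 n)) i x * g x \<partial>M) \<longlonglongrightarrow> l"
      by (simp add: o_def)
    have "(\<lambda>k. (\<Sum>n<N k. \<integral>x. b (s1 (s2 n)) i x * g x \<partial>M) / real (N k)) \<longlonglongrightarrow> l"
      using LIMSEQ_subseq_LIMSEQ[OF arithmetic_means_tendsto[OF l] N(1)] by (simp add: o_def)
    moreover have "(\<Sum>n<N k. \<integral>x. b (s1 (s2 n)) i x * g x \<partial>M) / real (N k) = (\<integral>x. S k i x * g x \<partial>M)" for k
      using int_b by (simp add: S_def sum_distrib_right)
    ultimately have "(\<lambda>k. \<integral>x. S k i x * g x \<partial>M) \<longlonglongrightarrow> l"
      by simp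
    moreover have "(\<lambda>k. \<integral>x. S k i x * g x \<partial>M) \<longlonglongrightarrow> (\<integral>x. \<gamma> i x * g x \<partial>M)"
    proof (rule integral_dominated_convergence[where w = "\<lambda>x. C * \<bar>g x\<bar>"])
      show "AE x in M. (\<lambda>k. S k i x * g x) \<longlonglongrightarrow> \<gamma> i x * g x"
        using lim_S by eventually_elim (intro tendsto_intros, simp)
      show "AE x in M. norm (S k i x * g x) \<le> C * \<bar>g x\<bar>" for k
        using S_le by (auto simp: abs_mult intro!: mult_right_mono)
      show "integrable M (\<lambda>x. C * \<bar>g x\<bar>)"
        using g by simp
    qed (use S_meas \<gamma>_meas g in \<open>auto intro!: borel_measurable_times\<close>)
    ultimately have "l = (\<integral>x. \<gamma> i x * g x \<partial>M)"
      by (rule LIMSEQ_unique)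
    with l show ?thesis by simp
  qed
  then show ?thesis
    using \<gamma>_meas \<gamma>_le lim_S
    by (intro that[of "s1 \<circ> s2" N \<gamma>] strict_mono_o s1 s2 N) (simp_all add: S_def)
qed

text \<open>A positive integrable density h makes the measure finite without changing its null sets,
  and g / h turns a test function for M into one for the weighted measure. One subsequence and one N
  then work on the whole line, with no diagonal argument over bounded intervals.\<close>

theorem weak_and_mean_convergent_subsequence:
  fixes M :: "'a::second_countable_topology measure" and b :: "nat \<Rightarrow> 'i::finite \<Rightarrow> 'a \<Rightarrow> real"
  assumes sf: "sigma_finite_measure M" and M: "sets M = sets borel"
    and b: "\<And>n i. b n i \<in> borel_measurable M" "\<And>n i x. \<bar>b n i x\<bar> \<le> C"
  obtains s N \<gamma> where "strict_mono s" "strict_mono N"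
    "\<forall>i. \<gamma> i \<in> borel_measurable M" "\<forall>i x. \<bar>\<gamma> i x\<bar> \<le> C"
    "AE x in M. \<forall>i. (\<lambda>k. (\<Sum>n<N k. b (s n) i x) / real (N k)) \<longlonglongrightarrow> \<gamma> i x"
    "\<forall>i g. integrable M g \<longrightarrow> (\<lambda>n. \<integral>x. b (s n) i x * g x \<partial>M) \<longlonglongrightarrow> (\<integral>x. \<gamma> i x * g x \<partial>M)"
proof -
  interpret sigma_finite_measure M by fact
  have sp: "space M = UNIV"
    using sets_eq_imp_space_eq[OF M] by simp
  obtain h0 where h0: "h0 \<in> borel_measurable M" "integral\<^sup>N M h0 \<noteq> \<infinity>" "\<forall>x\<in>space M. 0 < h0 x \<and> h0 x < \<infinity>"
    using Ex_finite_integrable_function by blast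
  define h where "h x = enn2real (h0 x)" for x
  have h_meas [measurable]: "h \<in> borel_measurable M"
    unfolding h_def using h0(1) by measurable
  have h_pos: "0 < h x" for x
    using h0(3) by (simp add: h_def enn2real_positive_iff sp)
  have h_eq: "ennreal (h x) = h0 x" for x
    using h0(3) by (simp add: h_def sp)
  have ae: "(AE x in density M h. P x) \<longleftrightarrow> (AE x in M. P x)" for P
    by (simp add: AE_density h_pos)
  have "finite_measure (density M h)"
  proof (rule finite_measureI)
    have "emeasure (density M h) (space M) = (\<integral>\<^sup>+x. ennreal (h x) \<partial>M)"
      by (subst emeasure_density) (auto intro!: nn_integral_cong)
    then show "emeasure (density M h) (space (density M h)) \<noteq> \<infinity>"
      using h0(2) by (simp add: h_eq)
  qed
  moreover have "sets (density M h) = sets borel"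
    by (simp add: M)
  moreover have "b n i \<in> borel_measurable (density M h)" for n i
    using b(1) by simp
  ultimately obtain s N \<gamma> where s: "strict_mono s" "strict_mono N"
    and \<gamma>: "\<forall>i. \<gamma> i \<in> borel_measurable (density M h)" "\<forall>i x. \<bar>\<gamma> i x\<bar> \<le> C"
    and means: "AE x in density M h. \<forall>i. (\<lambda>k. (\<Sum>n<N k. b (s n) i x) / real (N k)) \<longlonglongrightarrow> \<gamma> i x"
    and weak: "\<forall>i g. integrable (density M h) g \<longrightarrow>
      (\<lambda>n. \<integral>x. b (s n) i x * g x \<partial>density M h) \<longlonglongrightarrow> (\<integral>x. \<gamma> i x * g x \<partial>density M h)"
    by (rule weak_and_mean_convergent_subsequence_finite[where b = b, OF _ _ _ b(2)])
  have \<gamma>_meas: "\<gamma> i \<in> borel_measurable M" for i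
    using \<gamma>(1) by simp
  have "(\<lambda>n. \<integral>x. b (s n) i x * g x \<partial>M) \<longlonglongrightarrow> (\<integral>x. \<gamma> i x * g x \<partial>M)" if g: "integrable M g" for i g
  proof -
    have [measurable]: "g \<in> borel_measurable M"
      using g by simp
    have h_nz: "h x \<noteq> 0" for x
      using h_pos[of x] by simp
    have "integrable (density M h) (\<lambda>x. g x / h x)"
      using g h_pos by (subst integrable_density) (auto simp: less_imp_le h_nz)
    moreover have "(\<integral>x. f x * (g x / h x) \<partial>density M h) = (\<integral>x. f x * g x \<partial>M)"
      if [measurable]: "f \<in> borel_measurable M" for f :: "'a \<Rightarrow> real"
    proof -
      have "(\<integral>x. f x * (g x / h x) \<partial>density M h) = (\<integral>x. h x *\<^sub>R (f x * (g x / h x)) \<partial>M)"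
        using h_pos by (intro integral_density) (auto simp: less_imp_le)
      also have "\<dots> = (\<integral>x. f x * g x \<partial>M)"
        by (simp add: h_nz)
      finally show ?thesis .
    qed
    ultimately show ?thesis
      using weak b(1) \<gamma>_meas by (auto dest!: spec[of _ i] spec[of _ "\<lambda>x. g x / h x"])
  qed
  then show ?thesis
    using s \<gamma>(2) \<gamma>_meas means[unfolded ae] by (intro that[of s N \<gamma>]) simp_all
qed

section \<open>Limits of interpolants\<close>

text \<open>The positive parts are eventually zero, so their means tend to 0, and these dominate the
  given means. Finitely many wrong signs are thus harmless.\<close>

lemma means_limit_nonpos:
  fixes x :: "nat \<Rightarrow> real"
  assumes x: "\<forall>\<^sub>F n in sequentially. x n \<le> 0" and N: "strict_mono N"
    and lim: "(\<lambda>k. (\<Sum>n<N k. x n) / real (N k)) \<longlonglongrightarrow> l"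
  shows "l \<le> 0"
proof -
  have "(\<lambda>n. max (x n) 0) \<longlonglongrightarrow> 0"
    by (rule tendsto_eventually) (use x in \<open>eventually_elim, auto\<close>)
  from LIMSEQ_subseq_LIMSEQ[OF arithmetic_means_tendsto[OF this] N]
  have "(\<lambda>k. (\<Sum>n<N k. max (x n) 0) / real (N k)) \<longlonglongrightarrow> 0"
    by (simp add: o_def)
  then show ?thesis
    by (rule LIMSEQ_le[OF lim]) (auto intro!: divide_right_mono sum_mono)
qed

lemma means_limit_nonneg:
  fixes x :: "nat \<Rightarrow> real"
  assumes x: "\<forall>\<^sub>F n in sequentially. 0 \<le> x n" and N: "strict_mono N"
    and lim: "(\<lambda>k. (\<Sum>n<N k. x n) / real (N k)) \<longlonglongrightarrow> l"
  shows "0 \<le> l"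
proof -
  have "(\<lambda>k. (\<Sum>n<N k. - x n) / real (N k)) \<longlonglongrightarrow> - l"
    using tendsto_minus[OF lim] by (simp add: sum_negf)
  then have "- l \<le> 0"
    by (rule means_limit_nonpos[rotated 2]) (use x N in auto)
  then show ?thesis by simp
qed

text \<open>An Arzela-Ascoli argument for functions with jumps: \<open>e n\<close> allows for the
  jumps and disappears in the limit, so convergence at rational times spreads to all times and the
  limit is Lipschitz without defect.\<close>

lemma asymptotically_lipschitz_subsequence:
  fixes u :: "nat \<Rightarrow> 'i::countable \<Rightarrow> real \<Rightarrow> real"
  assumes bound: "\<And>n i t. \<bar>u n i t\<bar> \<le> C"
    and lip: "\<And>n i t s. \<bar>u n i t - u n i s\<bar> \<le> K * (\<bar>t - s\<bar> + e n)"
    and e: "e \<longlonglongrightarrow> 0" and K: "0 \<le> K"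
  obtains s v where "strict_mono s" "\<forall>i t. (\<lambda>n. u (s n) i t) \<longlonglongrightarrow> v i t"
    "\<forall>i t t'. \<bar>v i t - v i t'\<bar> \<le> K * \<bar>t - t'\<bar>"
proof -
  have cnt: "countable (UNIV \<times> \<rat> :: ('i \<times> real) set)"
    by (intro countable_SIGMA) (auto simp: countable_rat)
  show ?thesis
  proof (rule function_convergent_subsequence[where f = "\<lambda>n p. u n (fst p) (snd p)", OF cnt])
    show "norm (u n (fst p) (snd p)) \<le> C" for n p
      using bound by simp
    fix s :: "nat \<Rightarrow> nat"
    assume s: "strict_mono s"
      "\<And>p. p \<in> UNIV \<times> \<rat> \<Longrightarrow> \<exists>l. (\<lambda>n. u (s n) (fst p) (snd p)) \<longlonglongrightarrow> l"
    have es: "(\<lambda>n. e (s n)) \<longlonglongrightarrow> 0"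
      using LIMSEQ_subseq_LIMSEQ[OF e s(1)] by (simp add: o_def)
    have "convergent (\<lambda>n. u (s n) i t)" for i t
    proof (rule convergent_uniform_approx)
      fix d :: real assume d: "0 < d"
      \<comment> \<open>One d' covers the distance from t to a rational time, the other the defect
        e; \<open>K + 1\<close> avoids division by zero.\<close>
      define d' where "d' = d / (K + 1) / 2"
      have d': "0 < d'" using d K by (simp add: d'_def)
      have Kd': "K * (d' + d') \<le> d"
      proof -
        have "K * (d' + d') \<le> (K + 1) * (d' + d')"
          using d' by (intro mult_right_mono) auto
        also have "\<dots> = d"
        proof -
          have "d' + d' = d / (K + 1)"
            by (simp only: d'_def field_sum_of_halves)
          then show ?thesis
            using K by simp
        qed
        finally show ?thesis .
      qed
      obtain q where q: "q \<in> \<rat>" "t < q" "q < t + d'"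
        using Rats_dense_in_real[of t "t + d'"] d' by auto
      have "convergent (\<lambda>n. u (s n) i q)"
        using s(2)[of "(i, q)"] q by (simp add: convergent_def)
      moreover have "\<forall>\<^sub>F n in sequentially. dist (u (s n) i t) (u (s n) i q) \<le> d"
        using order_tendstoD(2)[OF es d']
      proof eventually_elim
        case (elim n)
        have "\<bar>u (s n) i t - u (s n) i q\<bar> \<le> K * (\<bar>t - q\<bar> + e (s n))"
          by (rule lip)
        also have "\<dots> \<le> K * (d' + d')"
          using q elim K by (intro mult_left_mono) auto
        finally show ?case
          using Kd' by (simp add: dist_real_def)
      qed
      ultimately show "\<exists>x. convergent x \<and> (\<forall>\<^sub>F n in sequentially. dist (u (s n) i t) (x n) \<le> d)"
        by blast
    qed
    then have lim: "(\<lambda>n. u (s n) i t) \<longlonglongrightarrow> lim (\<lambda>n. u (s n) i t)" for i t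
      by (simp add: convergent_LIMSEQ_iff)
    show ?thesis
    proof (rule that[OF s(1)])
      show "\<forall>i t. (\<lambda>n. u (s n) i t) \<longlonglongrightarrow> lim (\<lambda>n. u (s n) i t)"
        using lim by blast
      show "\<forall>i t t'. \<bar>lim (\<lambda>n. u (s n) i t) - lim (\<lambda>n. u (s n) i t')\<bar> \<le> K * \<bar>t - t'\<bar>"
      proof (intro allI)
        fix i t t'
        have "(\<lambda>n. K * (\<bar>t - t'\<bar> + e (s n))) \<longlonglongrightarrow> K * (\<bar>t - t'\<bar> + 0)"
          by (intro tendsto_intros es)
        then show "\<bar>lim (\<lambda>n. u (s n) i t) - lim (\<lambda>n. u (s n) i t')\<bar> \<le> K * \<bar>t - t'\<bar>"
          using LIMSEQ_le[OF tendsto_rabs[OF tendsto_diff[OF lim lim]]] lip by fastforce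
      qed
    qed
  qed
qed

text \<open>Only successor indices own a bounded interval: \<open>nat\<close> truncates negative
  values, so index 0 collects all s \<le> 0.\<close>

lemma nat_ceiling_eq_Suc_iff:
  assumes "0 < \<sigma>"
  shows "nat \<lceil>s / \<sigma>\<rceil> = Suc m \<longleftrightarrow> s \<in> {real m * \<sigma><..real (Suc m) * \<sigma>}"
proof -
  have "nat \<lceil>s / \<sigma>\<rceil> = Suc m \<longleftrightarrow> \<lceil>s / \<sigma>\<rceil> = int (Suc m)"
    by auto
  also have "\<dots> \<longleftrightarrow> real m < s / \<sigma> \<and> s / \<sigma> \<le> real (Suc m)"
    by (simp add: ceiling_eq_iff)
  also have "\<dots> \<longleftrightarrow> s \<in> {real m * \<sigma><..real (Suc m) * \<sigma>}"
    using assms by (simp add: pos_less_divide_eq pos_divide_le_eq)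
  finally show ?thesis .
qed

lemma measurable_step [measurable]:
  fixes w :: "nat \<Rightarrow> real"
  shows "(\<lambda>s::real. w (nat \<lceil>s / \<sigma>\<rceil>)) \<in> borel_measurable borel"
proof -
  have "(\<lambda>s::real. \<lceil>s / \<sigma>\<rceil>) \<in> borel \<rightarrow>\<^sub>M count_space UNIV"
    by measurable
  then show ?thesis
    by (rule measurable_compose) simp
qed

lemma integral_step:
  fixes w :: "nat \<Rightarrow> real"
  assumes \<sigma>: "0 < \<sigma>"
  shows "(LINT s|lborel. indicator {0<..real N * \<sigma>} s * w (nat \<lceil>s / \<sigma>\<rceil>)) = \<sigma> * (\<Sum>m<N. w (Suc m))"
proof -
  have eq: "indicator {0<..real N * \<sigma>} s * w (nat \<lceil>s / \<sigma>\<rceil>)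
      = (\<Sum>m<N. w (Suc m) * indicator {real m * \<sigma><..real (Suc m) * \<sigma>} s)" for s
  proof -
    have ind: "indicator {real m * \<sigma><..real (Suc m) * \<sigma>} s = (if nat \<lceil>s / \<sigma>\<rceil> = Suc m then 1 else 0 :: real)" for m
      by (simp only: nat_ceiling_eq_Suc_iff[OF \<sigma>] indicator_def of_bool_def)
    show ?thesis
    proof (cases "nat \<lceil>s / \<sigma>\<rceil>")
      case 0
      then have "s \<le> 0"
        using \<sigma> by (simp add: divide_le_0_iff)
      then show ?thesis
        unfolding ind using 0 by simp
    next
      case (Suc k)
      then have s: "real k * \<sigma> < s" "s \<le> real (Suc k) * \<sigma>"
        using nat_ceiling_eq_Suc_iff[OF \<sigma>, of s k] by auto
      have "0 < s"
        using s \<sigma> by (auto intro: le_less_trans[of _ "real k * \<sigma>"])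
      have "s \<le> real N * \<sigma> \<longleftrightarrow> k < N"
      proof
        assume "s \<le> real N * \<sigma>"
        then have "real k * \<sigma> < real N * \<sigma>" using s by linarith
        then show "k < N" using \<sigma> by simp
      next
        assume "k < N"
        then have "real (Suc k) * \<sigma> \<le> real N * \<sigma>"
          using \<sigma> by (intro mult_right_mono) auto
        then show "s \<le> real N * \<sigma>" using s by linarith
      qed
      then show ?thesis
        unfolding ind using Suc \<open>0 < s\<close> by (auto simp: indicator_def if_distrib[of "\<lambda>x. _ * x"] cong: if_cong)
    qed
  qed
  have "(LINT s|lborel. w (Suc m) * indicator {real m * \<sigma><..real (Suc m) * \<sigma>} s) = \<sigma> * w (Suc m)" for m
    using \<sigma> by (simp add: left_diff_distrib[symmetric])
  moreover have "(LINT s|lborel. (\<Sum>m<N. w (Suc m) * indicator {real m * \<sigma><..real (Suc m) * \<sigma>} s))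
      = (\<Sum>m<N. (LINT s|lborel. w (Suc m) * indicator {real m * \<sigma><..real (Suc m) * \<sigma>} s))"
    by (rule Bochner_Integration.integral_sum) (use \<sigma> in auto)
  ultimately show ?thesis
    unfolding eq by (simp only: sum_distrib_left)
qed

text \<open>At most (t - s) / \<sigma> + 1 grid steps separate the two indices when s \<le> t; the
  one step lost to rounding is the extra \<sigma>.\<close>

lemma step_lipschitz:
  fixes w :: "nat \<Rightarrow> real"
  assumes \<sigma>: "0 < \<sigma>" and K: "0 \<le> K" and w: "\<And>m. \<bar>w (Suc m) - w m\<bar> \<le> K * \<sigma>"
  shows "\<bar>w (nat \<lceil>t / \<sigma>\<rceil>) - w (nat \<lceil>s / \<sigma>\<rceil>)\<bar> \<le> K * (\<bar>t - s\<bar> + \<sigma>)"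
proof -
  have chain: "\<bar>w (m + n) - w m\<bar> \<le> K * \<sigma> * real n" for m n
  proof (induction n)
    case (Suc n)
    then show ?case
      using w[of "m + n"] by (simp add: algebra_simps abs_le_iff)
  qed simp
  have *: "\<bar>w (nat \<lceil>t / \<sigma>\<rceil>) - w (nat \<lceil>s / \<sigma>\<rceil>)\<bar> \<le> K * (\<bar>t - s\<bar> + \<sigma>)" if "s \<le> t" for s t
  proof -
    let ?m = "nat \<lceil>s / \<sigma>\<rceil>" and ?n = "nat \<lceil>t / \<sigma>\<rceil>"
    have st: "s / \<sigma> \<le> t / \<sigma>"
      using that \<sigma> by (simp add: divide_right_mono)
    then have mn: "?m \<le> ?n"
      by (intro nat_mono ceiling_mono)
    have "real (?n - ?m) \<le> t / \<sigma> - s / \<sigma> + 1"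
    \<comment> \<open>Negative times are truncated by \<open>nat\<close>. If the indices differ, the
      larger one is positive and hence exact, and truncating the smaller one only shortens the
      distance.\<close>
    proof (cases "?n = ?m")
      case False
      then have "0 \<le> \<lceil>t / \<sigma>\<rceil>" using mn by linarith
      then have "real (?n - ?m) \<le> of_int \<lceil>t / \<sigma>\<rceil> - of_int \<lceil>s / \<sigma>\<rceil>"
        using mn by (simp add: of_nat_diff)
      also have "\<dots> \<le> t / \<sigma> - s / \<sigma> + 1"
        using ceiling_correct[of "t / \<sigma>"] ceiling_correct[of "s / \<sigma>"] by linarith
      finally show ?thesis .
    qed (use st in simp)
    then have "K * \<sigma> * real (?n - ?m) \<le> K * \<sigma> * (t / \<sigma> - s / \<sigma> + 1)"
      using K \<sigma> by (intro mult_left_mono) auto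
    also have "\<dots> = K * (\<bar>t - s\<bar> + \<sigma>)"
      using \<sigma> that by (simp add: field_simps)
    finally show ?thesis
      using chain[of ?m "?n - ?m"] mn by simp
  qed
  show ?thesis
    using *[of s t] *[of t s] by (cases "s \<le> t") (auto simp: abs_minus_commute)
qed

text \<open>Telescoping costs N K \<sigma>^2 with N \<sigma> \<le> t + \<sigma>. The sum is an
  integral up to N \<sigma>, which overshoots t by at most one step and so costs H \<sigma>
  more.\<close>

lemma step_integral_equation:
  fixes v w :: "nat \<Rightarrow> real"
  assumes \<sigma>: "0 < \<sigma>" and t: "0 \<le> t" and K: "0 \<le> K"
    and step: "\<And>m. \<bar>(v (Suc m) - v m) - \<sigma> * w (Suc m)\<bar> \<le> K * \<sigma>\<^sup>2"
    and w: "\<And>m. \<bar>w (Suc m)\<bar> \<le> H"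
  shows "\<bar>v (nat \<lceil>t / \<sigma>\<rceil>) - v 0 - (LINT s|lborel. indicator {0<..t} s * w (nat \<lceil>s / \<sigma>\<rceil>))\<bar> \<le> (K * (t + \<sigma>) + H) * \<sigma>"
proof -
  define N where "N = nat \<lceil>t / \<sigma>\<rceil>"
  have H: "0 \<le> H"
    using w[of 0] by linarith
  have "t / \<sigma> \<le> real N" "real N \<le> t / \<sigma> + 1"
    using t \<sigma> ceiling_correct[of "t / \<sigma>"] by (auto simp: N_def)
  then have N: "t \<le> real N * \<sigma>" "real N * \<sigma> \<le> t + \<sigma>"
    using \<sigma> by (simp_all add: field_simps)
  have tele: "\<bar>v N - v 0 - \<sigma> * (\<Sum>m<N. w (Suc m))\<bar> \<le> real N * (K * \<sigma>\<^sup>2)" for N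
  proof (induction N)
    case (Suc N)
    then show ?case
      using step[of N] by (simp add: algebra_simps abs_le_iff)
  qed simp
  have meas: "(\<lambda>s. indicator S s * w (nat \<lceil>s / \<sigma>\<rceil>)) \<in> borel_measurable borel" if "S \<in> sets borel" for S
    using that by measurable
  \<comment> \<open>Nothing bounds \<open>w 0\<close>, but index 0 occurs only for s \<le>
    0.\<close>
  have bnd: "\<bar>w (nat \<lceil>s / \<sigma>\<rceil>)\<bar> \<le> H" if "0 < s" for s
  proof -
    have "0 < \<lceil>s / \<sigma>\<rceil>" using that \<sigma> by simp
    then obtain m where "nat \<lceil>s / \<sigma>\<rceil> = Suc m"
      by (metis gr0_conv_Suc zero_less_nat_eq)
    then show ?thesis using w by simp
  qed
  have int: "integrable lborel (\<lambda>s. indicator {x<..y} s * w (nat \<lceil>s / \<sigma>\<rceil>))" if "0 \<le> x" "x \<le> y" for x y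
    by (rule integrableI_bounded_set[where A = "{x<..y}" and B = H])
       (use that bnd meas in \<open>auto simp: indicator_def\<close>)
  have split: "indicator {0<..real N * \<sigma>} s = indicator {0<..t} s + (indicator {t<..real N * \<sigma>} s :: real)" for s
    using t N by (auto simp: indicator_def)
  have "\<sigma> * (\<Sum>m<N. w (Suc m)) = (LINT s|lborel. indicator {0<..t} s * w (nat \<lceil>s / \<sigma>\<rceil>))
      + (LINT s|lborel. indicator {t<..real N * \<sigma>} s * w (nat \<lceil>s / \<sigma>\<rceil>))"
    unfolding integral_step[OF \<sigma>, symmetric] split distrib_right
    using int t N by (intro Bochner_Integration.integral_add) auto
  moreover have "\<bar>LINT s|lborel. indicator {t<..real N * \<sigma>} s * w (nat \<lceil>s / \<sigma>\<rceil>)\<bar> \<le> H * \<sigma>"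
  proof -
    have "\<bar>LINT s|lborel. indicator {t<..real N * \<sigma>} s * w (nat \<lceil>s / \<sigma>\<rceil>)\<bar>
        \<le> (LINT s|lborel. \<bar>indicator {t<..real N * \<sigma>} s * w (nat \<lceil>s / \<sigma>\<rceil>)\<bar>)"
      by (rule integral_abs_bound)
    also have "\<dots> \<le> (LINT s|lborel. H * indicator {t<..real N * \<sigma>} s)"
    proof (rule integral_mono)
      show "\<bar>indicator {t<..real N * \<sigma>} s * w (nat \<lceil>s / \<sigma>\<rceil>)\<bar> \<le> H * indicator {t<..real N * \<sigma>} s" for s
        using bnd[of s] t by (auto simp: indicator_def)
    qed (use int[of t "real N * \<sigma>"] t N in auto)
    also have "\<dots> = H * (real N * \<sigma> - t)"
      using N by simp
    also have "\<dots> \<le> H * \<sigma>"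
      using N H by (intro mult_left_mono) auto
    finally show ?thesis .
  qed
  moreover have "real N * (K * \<sigma>\<^sup>2) \<le> K * (t + \<sigma>) * \<sigma>"
    using mult_right_mono[OF N(2), of "K * \<sigma>"] K \<sigma> by (simp add: power2_eq_square mult_ac)
  ultimately show ?thesis
    using tele[of N] unfolding N_def[symmetric] by (simp add: distrib_right abs_le_iff)
qed

section \<open>Lebesgue and Sobolev functions on intervals\<close>

lemma integrable_lebesgue_on_bounded:
  fixes f :: "real \<Rightarrow> real"
  assumes S: "S \<in> lmeasurable" and f: "f \<in> borel_measurable borel" "\<And>x. \<bar>f x\<bar> \<le> C"
  shows "integrable (lebesgue_on S) f"
proof -
  interpret finite_measure "lebesgue_on S"
    using S by (rule finite_measure_lebesgue_on)
  show ?thesis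
    using f by (intro integrable_const_bound[of _ C]) (auto intro!: measurable_restrict_space1 measurable_completion)
qed

lemma bounded_imp_L2_on:
  assumes S: "S \<in> lmeasurable" and f: "f \<in> borel_measurable borel" "\<And>x. \<bar>f x\<bar> \<le> C"
  shows "L2_on S f"
  unfolding L2_on_def
proof
  show "f \<in> borel_measurable (lebesgue_on S)"
    using f by (auto intro!: measurable_restrict_space1 measurable_completion)
  have "\<bar>(f x)\<^sup>2\<bar> \<le> C\<^sup>2" for x
    using f(2)[of x] by (simp add: abs_le_square_iff[symmetric])
  then show "integrable (lebesgue_on S) (\<lambda>t. (f t)\<^sup>2)"
    using f(1) by (intro integrable_lebesgue_on_bounded[OF S]) auto
qed

lemma bounded_imp_Linf_on:
  assumes f: "f \<in> borel_measurable borel" "\<And>x. \<bar>f x\<bar> \<le> C"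
  shows "Linf_on S f"
  unfolding Linf_on_def using f by (auto intro!: measurable_restrict_space1 measurable_completion exI[of _ C])

lemma L2_on_imp_L1_on:
  assumes S: "S \<in> lmeasurable" and f: "L2_on S f"
  shows "L1_on S f"
proof -
  interpret finite_measure "lebesgue_on S"
    using S by (rule finite_measure_lebesgue_on)
  have "integrable (lebesgue_on S) (\<lambda>t. 1 + (f t)\<^sup>2)"
    using f by (simp add: L2_on_def)
  then show ?thesis
    unfolding L1_on_def
  proof (rule Bochner_Integration.integrable_bound)
    have "\<bar>y\<bar> \<le> 1 + y\<^sup>2" for y :: real
    proof (cases "\<bar>y\<bar> \<le> 1")
      case False
      then have "\<bar>y\<bar> * 1 \<le> \<bar>y\<bar> * \<bar>y\<bar>" by (intro mult_left_mono) auto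
      then show ?thesis by (simp add: power2_eq_square)
    qed (simp add: add_increasing2)
    then show "AE x in lebesgue_on S. norm (f x) \<le> norm (1 + (f x)\<^sup>2)"
      by auto
  qed (use f in \<open>simp add: L2_on_def\<close>)
qed

lemma integral_lebesgue_on_borel:
  fixes f :: "real \<Rightarrow> real"
  assumes S: "S \<in> sets borel" and f: "f \<in> borel_measurable borel"
  shows "(LINT t|lebesgue_on S. f t) = (LINT t|lborel. indicator S t * f t)"
proof -
  have "(LINT t|lebesgue_on S. f t) = (LINT t|lebesgue. indicator S t *\<^sub>R f t)"
    using S by (intro integral_restrict_space) auto
  also have "\<dots> = (LINT t|lborel. indicator S t *\<^sub>R f t)"
    using S f by (intro integral_completion) auto
  finally show ?thesis by simp
qed

text \<open>The test function is only Lebesgue measurable, so one Borel representative g is fixed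
  for all bounded Borel h. It vanishes for t \<le> 0, including the null point 0, so that obstacle
  values of index 0 drop out of the integrals.\<close>

lemma L1_on_test_function:
  assumes \<phi>: "L1_on {0..T} \<phi>"
  shows "\<exists>g. integrable lborel g \<and> (\<forall>t\<le>0. g t = 0) \<and>
    (\<forall>h C. h \<in> borel_measurable borel \<and> (\<forall>t. \<bar>h t\<bar> \<le> C) \<longrightarrow>
       integrable (lebesgue_on {0..T}) (\<lambda>t. h t * \<phi> t) \<and>
       (LINT t|lebesgue_on {0..T}. h t * \<phi> t) = (LINT t|lborel. h t * g t))"
proof -
  have int: "integrable lebesgue (\<lambda>t. indicator {0..T} t * \<phi> t)"
    using \<phi> by (simp add: L1_on_def integrable_restrict_space)
  then obtain g0 where g0: "g0 \<in> borel_measurable lborel" "AE t in lborel. indicator {0..T} t * \<phi> t = g0 t"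
    using completion_ex_borel_measurable_real[of "\<lambda>t. indicator {0..T} t * \<phi> t" lborel] by auto
  define g where "g t = indicator {0<..} t * g0 t" for t
  have g_meas [measurable]: "g \<in> borel_measurable borel"
    unfolding g_def using g0(1) by simp
  have "AE t in lborel. indicator {0..T} t * \<phi> t = g t"
    using g0(2) AE_lborel_singleton[of 0]
    by eventually_elim (auto simp: g_def indicator_def split: if_splits)
  then have ae: "AE t in lebesgue. indicator {0..T} t * \<phi> t = g t"
    by (rule AE_completion)
  have "integrable lebesgue g"
    using int by (rule integrable_cong_AE_imp) (use ae in \<open>auto intro!: measurable_completion\<close>)
  then have g_int: "integrable lborel g"
    by (simp add: integrable_completion)
  show ?thesis
  proof (intro exI[of _ g] conjI g_int)
    show "\<forall>t\<le>0. g t = 0" by (simp add: g_def)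
    show "\<forall>h C. h \<in> borel_measurable borel \<and> (\<forall>t. \<bar>h t\<bar> \<le> C) \<longrightarrow>
       integrable (lebesgue_on {0..T}) (\<lambda>t. h t * \<phi> t) \<and>
       (LINT t|lebesgue_on {0..T}. h t * \<phi> t) = (LINT t|lborel. h t * g t)"
    proof (intro allI impI, elim conjE)
      fix h :: "real \<Rightarrow> real" and C
      assume [measurable]: "h \<in> borel_measurable borel" and h: "\<forall>t. \<bar>h t\<bar> \<le> C"
      have hm: "h \<in> borel_measurable (lebesgue_on {0..T})"
        by (auto intro!: measurable_restrict_space1 measurable_completion)
      have i: "integrable (lebesgue_on {0..T}) (\<lambda>t. h t * \<phi> t)"
        using \<phi> h by (intro integrable_bounded_mult[OF hm]) (auto simp: L1_on_def)
      have "(LINT t|lebesgue_on {0..T}. h t * \<phi> t) = (LINT t|lebesgue. indicator {0..T} t *\<^sub>R (h t * \<phi> t))"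
        by (intro integral_restrict_space) auto
      also have "\<dots> = (LINT t|lebesgue. h t * g t)"
      proof (rule integral_cong_AE)
        show "(\<lambda>t. indicator {0..T} t *\<^sub>R (h t * \<phi> t)) \<in> borel_measurable lebesgue"
          using i by (simp add: integrable_restrict_space borel_measurable_integrable)
        show "AE t in lebesgue. indicator {0..T} t *\<^sub>R (h t * \<phi> t) = h t * g t"
          using ae by eventually_elim (simp add: mult_ac)
      qed (auto intro!: measurable_completion)
      also have "\<dots> = (LINT t|lborel. h t * g t)"
        by (intro integral_completion) simp
      finally show "integrable (lebesgue_on {0..T}) (\<lambda>t. h t * \<phi> t) \<and>
         (LINT t|lebesgue_on {0..T}. h t * \<phi> t) = (LINT t|lborel. h t * g t)"
        using i by simp
    qed
  qed
qed

section \<open>Test functions and weak derivatives\<close>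

lemma test_fun_derivD:
  assumes "test_fun a b \<phi>"
  shows "(\<phi> has_real_derivative deriv \<phi> x) (at x)" "continuous_on UNIV (deriv \<phi>)"
proof -
  have d: "((deriv ^^ k) \<phi>) differentiable (at x)" for k x
    using assms by (simp add: test_fun_def)
  show "(\<phi> has_real_derivative deriv \<phi> x) (at x)"
    using d[of 0 x] by (simp add: DERIV_deriv_iff_real_differentiable)
  show "continuous_on UNIV (deriv \<phi>)"
    using d[of 1] by (auto simp: continuous_on_eq_continuous_at intro: differentiable_imp_continuous_within)
qed

text \<open>The support is compact inside the open interval, so \<phi> vanishes in a neighbourhood
  of x and the derivative vanishes too, even at the endpoints.\<close>

lemma test_fun_zero:
  assumes "test_fun a b \<phi>" "x \<le> a \<or> b \<le> x"
  shows "\<phi> x = 0" "deriv \<phi> x = 0"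
proof -
  obtain c d where cd: "a < c" "d < b" "\<forall>x. x \<notin> {c..d} \<longrightarrow> \<phi> x = 0"
    using assms by (auto simp: test_fun_def)
  have x: "x \<in> - {c..d}"
    using assms cd by auto
  then show "\<phi> x = 0"
    using cd by auto
  have "open (- {c..d})"
    by (simp add: open_Compl)
  then have "\<forall>\<^sub>F y in nhds x. \<phi> y = 0"
    using cd x by (auto simp: eventually_nhds)
  then have "deriv \<phi> x = deriv (\<lambda>_. 0) x"
    by (intro deriv_cong_ev) auto
  then show "deriv \<phi> x = 0"
    by simp
qed

text \<open>Integration by parts against a test function is Fubini's theorem on the triangle \<open>s \<le> t\<close>.\<close>
lemma H1_with_deriv_integral:
  fixes f g :: "real \<Rightarrow> real"
  assumes ab: "0 \<le> a" "a < b"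
    and f: "f \<in> borel_measurable borel" "\<And>t. \<bar>f t\<bar> \<le> C"
    and g: "g \<in> borel_measurable borel" "\<And>t. \<bar>g t\<bar> \<le> C"
    and fg: "\<And>t. 0 \<le> t \<Longrightarrow> f t = f0 + (LINT s|lborel. indicator {0<..t} s * g s)"
  shows "H1_with_deriv a b f g"
  unfolding H1_with_deriv_def
proof (intro conjI allI impI)
  show "L2_on {a<..<b} f" "L2_on {a<..<b} g"
    using f g by (auto intro!: bounded_imp_L2_on[where C = C])
  fix \<phi> assume \<phi>: "test_fun a b \<phi>"
  note D = test_fun_derivD[OF \<phi>] and Z = test_fun_zero[OF \<phi>]
  note [measurable] = f(1) g(1)
  have \<phi>_cont: "continuous_on UNIV \<phi>"
    using D(1) by (auto simp: continuous_on_eq_continuous_at intro: DERIV_isCont)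
  have [measurable]: "\<phi> \<in> borel_measurable borel" "deriv \<phi> \<in> borel_measurable borel"
    using D(2) \<phi>_cont by (auto intro: borel_measurable_continuous_onI)
  have "compact (deriv \<phi> ` {a..b})"
    using D(2) by (intro compact_continuous_image) (auto intro: continuous_on_subset)
  then have "bounded (deriv \<phi> ` {a..b})"
    by (rule compact_imp_bounded)
  then obtain P where P: "\<forall>x\<in>{a..b}. \<bar>deriv \<phi> x\<bar> \<le> P"
    by (auto simp: bounded_iff)
  have P0: "0 \<le> P"
    using P ab by (auto dest: bspec[of _ _ a] intro: order_trans[OF abs_ge_zero])
  have C0: "0 \<le> C"
    using f(2)[of 0] by linarith
  have FTC: "(LINT t|lborel. indicator {x..b} t * deriv \<phi> t) = - \<phi> x" if "x \<le> b" for x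
    using integral_FTC_atLeastAtMost[of x b \<phi> "deriv \<phi>"] that D Z(1)[of b]
    by (auto simp: has_real_derivative_iff_has_vector_derivative[symmetric]
        intro: has_vector_derivative_at_within continuous_on_subset DERIV_subset)
  \<comment> \<open>Integrated over s, the kernel gives \<phi>' (f - f0); integrated over t, it
    gives -g \<phi> by \<open>FTC\<close>. Cutting s at b makes k bounded and zero outside a
    rectangle of finite measure.\<close>
  define k where "k t s = deriv \<phi> t * (indicator {0<..b} s * g s * (if s \<le> t then 1 else 0))" for t s
  have k_int: "integrable (lborel \<Otimes>\<^sub>M lborel) (case_prod k)"
  proof (rule integrableI_bounded_set[where A = "{a..b} \<times> {0<..b}" and B = "P * C"])
    show "case_prod k \<in> borel_measurable (lborel \<Otimes>\<^sub>M lborel)"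
      unfolding k_def by measurable
    show "emeasure (lborel \<Otimes>\<^sub>M lborel) ({a..b} \<times> {0<..b}) < \<infinity>"
      using ab by (simp add: lborel.emeasure_pair_measure_Times ennreal_mult_less_top)
    have "\<bar>k t s\<bar> \<le> P * C" if "t \<in> {a..b}" for t s
      unfolding k_def abs_mult using P[rule_format, OF that] g(2)[of s] P0 C0
      by (intro mult_mono) (auto simp: indicator_def)
    then show "AE x in lborel \<Otimes>\<^sub>M lborel. x \<in> {a..b} \<times> {0<..b} \<longrightarrow> norm (case_prod k x) \<le> P * C"
      by auto
    show "AE x in lborel \<Otimes>\<^sub>M lborel. x \<notin> {a..b} \<times> {0<..b} \<longrightarrow> case_prod k x = 0"
    proof (intro AE_I2 impI)
      fix x assume "x \<notin> {a..b} \<times> {0<..b}"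
      then show "case_prod k x = 0"
        using Z(2)[of "fst x"] by (cases x) (auto simp: k_def indicator_def)
    qed
  qed (use ab in auto)
  have inner: "(LINT t|lborel. k t s) = - (indicator {0<..b} s * (g s * \<phi> s))" for s
  proof (cases "s \<in> {0<..b}")
    case True
    have "k t s = g s * (indicator {s..b} t * deriv \<phi> t)" for t
      using True Z(2)[of t] by (auto simp: k_def indicator_def)
    then show ?thesis
      using FTC[of s] True by simp
  qed (simp add: k_def)
  have outer: "f t * deriv \<phi> t = f0 * (indicator {a..b} t * deriv \<phi> t) + (LINT s|lborel. k t s)" for t
  proof (cases "t \<in> {a..b}")
    case True
    have "(LINT s|lborel. k t s) = deriv \<phi> t * (LINT s|lborel. indicator {0<..b} s * g s * (if s \<le> t then 1 else 0))"
      unfolding k_def by simp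
    also have "(LINT s|lborel. indicator {0<..b} s * g s * (if s \<le> t then 1 else 0))
        = (LINT s|lborel. indicator {0<..t} s * g s)"
      using True by (intro Bochner_Integration.integral_cong) (auto simp: indicator_def)
    finally show ?thesis
      using True ab fg[of t] by (simp add: algebra_simps)
  next
    case False
    then have "deriv \<phi> t = 0"
      using Z(2)[of t] by auto
    then show ?thesis
      by (simp add: k_def)
  qed
  have i1: "integrable lborel (\<lambda>t. indicator {a..b} t * deriv \<phi> t)"
    using borel_integrable_atLeastAtMost'[of a b "deriv \<phi>"] D(2)
    by (auto simp: set_integrable_def intro: continuous_on_subset)
  have i2: "integrable lborel (\<lambda>t. LINT s|lborel. k t s)"
    using lborel_pair.integrable_fst[OF k_int] .
  have ind: "indicator {a<..<b} t * deriv \<phi> t = deriv \<phi> t" "indicator {a<..<b} t * \<phi> t = \<phi> t"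
    "indicator {0<..b} t * \<phi> t = \<phi> t" for t
  proof -
    have "\<phi> t = 0 \<and> deriv \<phi> t = 0 \<or> a < t \<and> t < b"
      using Z[of t] by linarith
    then show "indicator {a<..<b} t * deriv \<phi> t = deriv \<phi> t" "indicator {a<..<b} t * \<phi> t = \<phi> t"
      "indicator {0<..b} t * \<phi> t = \<phi> t"
      using ab by (auto simp: indicator_def)
  qed
  have "(LINT t|lebesgue_on {a<..<b}. f t * deriv \<phi> t) = (LINT t|lborel. indicator {a<..<b} t * (f t * deriv \<phi> t))"
    by (rule integral_lebesgue_on_borel) auto
  also have "\<dots> = (LINT t|lborel. f t * deriv \<phi> t)"
    by (simp only: ind mult.left_commute[of "indicator _ _"])
  also have "\<dots> = f0 * (LINT t|lborel. indicator {a..b} t * deriv \<phi> t) + (LINT t|lborel. LINT s|lborel. k t s)"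
    unfolding outer using i1 i2 by simp
  \<comment> \<open>The initial value f0 drops out, since \<phi>' integrates to -\<phi>(a) =
    0.\<close>
  also have "\<dots> = (LINT s|lborel. LINT t|lborel. k t s)"
    using FTC[of a] ab Z(1)[of a] lborel_pair.Fubini_integral[OF k_int] by simp
  also have "\<dots> = - (LINT s|lborel. indicator {a<..<b} s * (g s * \<phi> s))"
    unfolding inner by (simp add: ind mult.left_commute[of "indicator _ _"])
  also have "(LINT s|lborel. indicator {a<..<b} s * (g s * \<phi> s)) = (LINT t|lebesgue_on {a<..<b}. g t * \<phi> t)"
    by (rule integral_lebesgue_on_borel[symmetric]) auto
  finally show "(LINT t|lebesgue_on {a<..<b}. f t * deriv \<phi> t) = - (LINT t|lebesgue_on {a<..<b}. g t * \<phi> t)" .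
qed

section \<open>Passage to the limit\<close>

text \<open>The obstacle terms converge only weakly, so their linear contribution is separated from
  the part in u, to which dominated convergence applies.\<close>

lemma flow_rhs_split:
  "flow_rhs \<omega> r \<epsilon> u \<beta> i = flow_rhs \<omega> r \<epsilon> u (\<lambda>_. 0) i + \<beta> i - meanV \<omega> r \<beta>"
  by (simp add: flow_rhs_def meanV_eq_sum[of _ _ "\<lambda>_. 0"])

lemma abs_flow_rhs_le:
  assumes u: "\<And>j. \<bar>u j\<bar> \<le> 1" and \<beta>: "\<And>j. \<bar>\<beta> j\<bar> \<le> K" and \<epsilon>: "0 \<le> \<epsilon>"
  shows "\<bar>flow_rhs \<omega> r \<epsilon> u \<beta> i\<bar> \<le> 2 + 2 * K + \<epsilon> * lap_bound \<omega> r"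
proof -
  have "\<bar>\<epsilon> * lap \<omega> r u i\<bar> \<le> \<epsilon> * lap_bound \<omega> r"
    unfolding abs_mult using abs_lap_le[of u 1 \<omega> r i] u \<epsilon> by (simp add: mult_left_mono)
  then show ?thesis
    unfolding flow_rhs_def
    using u[of i] \<beta>[of i] abs_meanV_le[of u 1 \<omega> r, OF u] abs_meanV_le[of \<beta> K \<omega> r, OF \<beta>] by linarith
qed

lemma tendsto_flow_rhs:
  assumes "\<And>i. ((\<lambda>n. u n i) \<longlongrightarrow> v i) F" "\<And>i. ((\<lambda>n. \<beta> n i) \<longlongrightarrow> \<gamma> i) F"
  shows "((\<lambda>n. flow_rhs \<omega> r \<epsilon> (u n) (\<beta> n) i) \<longlongrightarrow> flow_rhs \<omega> r \<epsilon> v \<gamma> i) F"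
  unfolding flow_rhs_def meanV_eq_sum lap_def by (intro tendsto_intros assms)

lemma borel_measurable_flow_rhs:
  assumes [measurable]: "\<And>i. (\<lambda>t. u t i) \<in> borel_measurable M" "\<And>i. (\<lambda>t. \<beta> t i) \<in> borel_measurable M"
  shows "(\<lambda>t. flow_rhs \<omega> r \<epsilon> (u t) (\<beta> t) i) \<in> borel_measurable M"
  unfolding flow_rhs_def meanV_eq_sum lap_def by measurable

text \<open>The obstacle terms are brought into the form b times an indicator, which weak
  convergence handles with that indicator as test function; the mean moves outside as a finite
  linear combination.\<close>

lemma integral_flow_rhs:
  fixes u b :: "real \<Rightarrow> 'v::finite \<Rightarrow> real"
  assumes u: "\<And>i. (\<lambda>s. u s i) \<in> borel_measurable borel" "\<And>s i. \<bar>u s i\<bar> \<le> 1"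
    and b: "\<And>i. (\<lambda>s. b s i) \<in> borel_measurable borel" "\<And>s i. \<bar>b s i\<bar> \<le> K" and \<epsilon>: "0 \<le> \<epsilon>"
  shows "(LINT s|lborel. indicator {0<..t} s * flow_rhs \<omega> r \<epsilon> (u s) (b s) i)
    = (LINT s|lborel. indicator {0<..t} s * flow_rhs \<omega> r \<epsilon> (u s) (\<lambda>_. 0) i)
      + (LINT s|lborel. b s i * indicator {0<..t} s)
      - meanV \<omega> r (\<lambda>j. LINT s|lborel. b s j * indicator {0<..t} s)"
proof -
  have i0: "integrable lborel (indicator {0<..t} :: real \<Rightarrow> real)"
    by (cases "0 \<le> t") auto
  have i1: "integrable lborel (\<lambda>s. b s j * indicator {0<..t} s)" for j
    using b by (intro integrable_bounded_mult[OF _ _ i0]) auto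
  have i2: "integrable lborel (\<lambda>s. indicator {0<..t} s * flow_rhs \<omega> r \<epsilon> (u s) (\<lambda>_. 0) i)"
    using borel_measurable_flow_rhs[of u borel "\<lambda>_ _. 0"] u abs_flow_rhs_le[of _ "\<lambda>_. 0" 0 \<epsilon> \<omega> r i, OF _ _ \<epsilon>]
    by (subst mult.commute) (intro integrable_bounded_mult[OF _ _ i0, where C = "2 + 2 * 0 + \<epsilon> * lap_bound \<omega> r"], auto)
  have i3: "integrable lborel (\<lambda>s. meanV \<omega> r (\<lambda>j. b s j * indicator {0<..t} s))"
    unfolding meanV_eq_sum by (intro Bochner_Integration.integrable_sum integrable_mult_right i1)
  have eq: "indicator {0<..t} s * flow_rhs \<omega> r \<epsilon> (u s) (b s) i
      = indicator {0<..t} s * flow_rhs \<omega> r \<epsilon> (u s) (\<lambda>_. 0) i + b s i * indicator {0<..t} s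
        - meanV \<omega> r (\<lambda>j. b s j * indicator {0<..t} s)" for s
  proof -
    have "meanV \<omega> r (\<lambda>j. b s j * indicator {0<..t} s) = indicator {0<..t} s * meanV \<omega> r (b s)"
      using meanV_cmult[of \<omega> r "indicator {0<..t} s" "b s"] by (simp add: mult.commute)
    then show ?thesis
      by (subst flow_rhs_split) (simp add: distrib_left right_diff_distrib mult.commute)
  qed
  have "(LINT s|lborel. meanV \<omega> r (\<lambda>j. b s j * indicator {0<..t} s))
      = meanV \<omega> r (\<lambda>j. LINT s|lborel. b s j * indicator {0<..t} s)"
    unfolding meanV_eq_sum by (simp add: Bochner_Integration.integral_sum integrable_mult_right i1)
  then show ?thesis
    unfolding eq using i1 i2 i3 by simp
qed

theorem theorem43:
  fixes \<omega> :: "'v::finite \<Rightarrow> 'v \<Rightarrow> real" and r \<epsilon> :: real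
    and u0 :: "'v \<Rightarrow> real" and \<tau> :: "nat \<Rightarrow> real"
    and U :: "real \<Rightarrow> nat \<Rightarrow> 'v \<Rightarrow> real" and B :: "real \<Rightarrow> nat \<Rightarrow> 'v \<Rightarrow> real"
  assumes "weighted_graph \<omega>" and "0 \<le> r" and "r \<le> 1" and "0 < \<epsilon>"
    and "\<forall>i. 0 \<le> u0 i \<and> u0 i \<le> 1" and "u0 \<noteq> (\<lambda>_. 0)" and "u0 \<noteq> (\<lambda>_. 1)"
    and "\<forall>n. 0 < \<tau> n" and "decseq \<tau>" and "\<tau> \<longlonglongrightarrow> 0"
    and "\<forall>\<sigma>. 0 < \<sigma> \<and> \<sigma> < \<epsilon> \<longrightarrow> semi_iter \<omega> r \<epsilon> \<sigma> (U \<sigma>) (B \<sigma>) \<and> U \<sigma> 0 = u0"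
  shows "\<exists>s uh \<gamma>. strict_mono s \<and> (\<forall>n. \<tau> (s n) < \<epsilon>) \<and>
     AC_solution \<omega> r \<epsilon> uh \<gamma> \<and> uh 0 = u0 \<and>
     weak_L2loc \<omega> r (\<lambda>n t. B (\<tau> (s n)) (nat \<lceil>t / \<tau> (s n)\<rceil>)) \<gamma> \<and>
     weakstar_Linfloc \<omega> r (\<lambda>n t. B (\<tau> (s n)) (nat \<lceil>t / \<tau> (s n)\<rceil>)) \<gamma> \<and>
     (\<forall>t\<ge>0. \<forall>i. (\<lambda>n. U (\<tau> (s n)) (nat \<lceil>t / \<tau> (s n)\<rceil>) i) \<longlonglongrightarrow> uh t i) \<and>
     (\<exists>N :: nat \<Rightarrow> nat. filterlim N at_top sequentially \<and>
        (AE t in lborel. 0 \<le> t \<longrightarrow>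
           (\<forall>i. (\<lambda>k. (1 / real (N k)) * (\<Sum>n<N k. B (\<tau> (s n)) (nat \<lceil>t / \<tau> (s n)\<rceil>) i))
                  \<longlonglongrightarrow> \<gamma> t i)))"
proof -
  note \<epsilon> = assms(4)
  let ?R = "flow_rhs \<omega> r \<epsilon>"
  obtain K where K: "0 \<le> K"
    and est: "\<forall>\<sigma> u \<beta>. 0 < \<sigma> \<and> \<sigma> < \<epsilon> \<and> semi_iter \<omega> r \<epsilon> \<sigma> u \<beta> \<and> u 0 = u0 \<longrightarrow> (\<forall>m i.
       (0 \<le> u m i \<and> u m i \<le> 1) \<and> \<bar>\<beta> (Suc m) i\<bar> \<le> K \<and> \<bar>u (Suc m) i - u m i\<bar> \<le> K * \<sigma> \<and>
       \<bar>\<epsilon> * (u (Suc m) i - u m i) - \<sigma> * ?R (u (Suc m)) (\<beta> (Suc m)) i\<bar> \<le> K * \<sigma>\<^sup>2)"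
    using semi_iter_estimates[OF assms(1) \<epsilon>, of u0 r] assms(5-7) by blast
  define H where "H = 2 + 2 * K + \<epsilon> * lap_bound \<omega> r"
  have H: "0 \<le> H"
    using K \<epsilon> lap_bound_nonneg[of \<omega> r] by (simp add: H_def)
  have "\<forall>\<^sub>F n in sequentially. \<tau> n < \<epsilon>"
    using order_tendstoD(2)[OF assms(10) \<epsilon>] .
  then obtain n0 where n0: "\<And>n. n0 \<le> n \<Longrightarrow> \<tau> n < \<epsilon>"
    by (auto simp: eventually_sequentially)
  \<comment> \<open>Iterates are given only for steps below \<epsilon>, so an initial segment of
    \<tau> is discarded.\<close>
  define \<sigma>0 where "\<sigma>0 n = \<tau> (n + n0)" for n
  have \<sigma>0: "0 < \<sigma>0 n" "\<sigma>0 n < \<epsilon>" for n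
    using assms(8) n0 by (auto simp: \<sigma>0_def)
  have \<sigma>0_lim: "\<sigma>0 \<longlonglongrightarrow> 0"
    unfolding \<sigma>0_def using assms(10) by (rule LIMSEQ_ignore_initial_segment)
  have it: "semi_iter \<omega> r \<epsilon> (\<sigma>0 n) (U (\<sigma>0 n)) (B (\<sigma>0 n))" "U (\<sigma>0 n) 0 = u0" for n
    using assms(11) \<sigma>0[of n] by auto
  have est0: "0 \<le> U (\<sigma>0 n) m i" "U (\<sigma>0 n) m i \<le> 1" "\<bar>B (\<sigma>0 n) (Suc m) i\<bar> \<le> K"
    "\<bar>U (\<sigma>0 n) (Suc m) i - U (\<sigma>0 n) m i\<bar> \<le> K * \<sigma>0 n"
    "\<bar>\<epsilon> * (U (\<sigma>0 n) (Suc m) i - U (\<sigma>0 n) m i)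
       - \<sigma>0 n * ?R (U (\<sigma>0 n) (Suc m)) (B (\<sigma>0 n) (Suc m)) i\<bar> \<le> K * (\<sigma>0 n)\<^sup>2" for n m i
    using est[rule_format, of "\<sigma>0 n" "U (\<sigma>0 n)" "B (\<sigma>0 n)" m i] \<sigma>0[of n] it[of n] by auto

  \<comment> \<open>The iterates are treated first: pointwise convergence survives further thinning,
    whereas convergence of the means along N need not.\<close>
  obtain s1 v where s1: "strict_mono s1"
    and v_lim: "\<forall>i t. (\<lambda>n. U (\<sigma>0 (s1 n)) (nat \<lceil>t / \<sigma>0 (s1 n)\<rceil>) i) \<longlonglongrightarrow> v i t"
    and v_lip: "\<forall>i t t'. \<bar>v i t - v i t'\<bar> \<le> K * \<bar>t - t'\<bar>"
  proof (rule asymptotically_lipschitz_subsequence[where u = "\<lambda>n i t. U (\<sigma>0 n) (nat \<lceil>t / \<sigma>0 n\<rceil>) i"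
        and C = 1 and K = K and e = \<sigma>0, OF _ _ \<sigma>0_lim K])
    show "\<bar>U (\<sigma>0 n) (nat \<lceil>t / \<sigma>0 n\<rceil>) i\<bar> \<le> 1" for n t i
      using est0(1,2)[of n "nat \<lceil>t / \<sigma>0 n\<rceil>" i] by (simp add: abs_le_iff)
    show "\<bar>U (\<sigma>0 n) (nat \<lceil>t / \<sigma>0 n\<rceil>) i - U (\<sigma>0 n) (nat \<lceil>s / \<sigma>0 n\<rceil>) i\<bar> \<le> K * (\<bar>t - s\<bar> + \<sigma>0 n)" for n t s i
      using step_lipschitz[of "\<sigma>0 n" K "\<lambda>m. U (\<sigma>0 n) m i"] \<sigma>0 K est0(4) by simp
  qed blast

  text \<open>The value \<open>B \<sigma> 0\<close> is unconstrained, so the obstacle terms are cut off at \<open>t = 0\<close>.\<close>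
  define b0 where "b0 \<sigma> i t = indicator {0<..} t * B \<sigma> (nat \<lceil>t / \<sigma>\<rceil>) i" for \<sigma> i and t :: real
  have b0_meas: "b0 \<sigma> i \<in> borel_measurable borel" for \<sigma> i
    unfolding b0_def using measurable_step[of "\<lambda>m. B \<sigma> m i" \<sigma>] by measurable
  have b0_le: "\<bar>b0 (\<sigma>0 n) i t\<bar> \<le> K" for n i t
  proof (cases "0 < t")
    case True
    then have "0 < \<lceil>t / \<sigma>0 n\<rceil>" using \<sigma>0[of n] by simp
    then obtain m where "nat \<lceil>t / \<sigma>0 n\<rceil> = Suc m"
      by (metis gr0_conv_Suc zero_less_nat_eq)
    then show ?thesis using est0(3)[of n m i] True by (simp add: b0_def)
  qed (use K in \<open>simp add: b0_def\<close>)
  obtain s2 N \<gamma> where s2: "strict_mono s2" and N: "strict_mono N"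
    and \<gamma>_meas: "\<forall>i. \<gamma> i \<in> borel_measurable lborel" and \<gamma>_le: "\<forall>i x. \<bar>\<gamma> i x\<bar> \<le> K"
    and means: "AE t in lborel. \<forall>i. (\<lambda>k. (\<Sum>n<N k. b0 (\<sigma>0 (s1 (s2 n))) i t) / real (N k)) \<longlonglongrightarrow> \<gamma> i t"
    and weak: "\<forall>i g. integrable lborel g \<longrightarrow>
      (\<lambda>n. LINT t|lborel. b0 (\<sigma>0 (s1 (s2 n))) i t * g t) \<longlonglongrightarrow> (LINT t|lborel. \<gamma> i t * g t)"
    using weak_and_mean_convergent_subsequence[where M = lborel and b = "\<lambda>n. b0 (\<sigma>0 (s1 n))" and C = K,
        OF lborel.sigma_finite_measure_axioms sets_lborel] b0_meas b0_le by auto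

  define s where "s n = s1 (s2 n) + n0" for n
  define \<sigma> where "\<sigma> n = \<tau> (s n)" for n
  have \<sigma>_eq: "\<sigma>0 (s1 (s2 n)) = \<sigma> n" for n
    by (simp add: \<sigma>_def \<sigma>0_def s_def)
  have s: "strict_mono s"
    using s1 s2 by (simp add: s_def strict_mono_def)
  have \<sigma>: "0 < \<sigma> n" "\<sigma> n < \<epsilon>" for n
    using \<sigma>0[of "s1 (s2 n)"] by (auto simp: \<sigma>_eq)
  have \<sigma>_lim: "\<sigma> \<longlonglongrightarrow> 0"
    using LIMSEQ_subseq_LIMSEQ[OF assms(10) s] unfolding o_def \<sigma>_def .
  note est' = est0[of "s1 (s2 _)", unfolded \<sigma>_eq]
  note b0_le' = b0_le[of "s1 (s2 _)", unfolded \<sigma>_eq]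
  note means' = means[unfolded \<sigma>_eq] and weak' = weak[unfolded \<sigma>_eq, rule_format]

  define u where "u n t i = U (\<sigma> n) (nat \<lceil>t / \<sigma> n\<rceil>) i" for n t i
  define b where "b n t i = b0 (\<sigma> n) i t" for n t i
  define uh where "uh t i = v i t" for t i
  define g where "g t i = \<gamma> i t" for t i
  have u_lim: "(\<lambda>n. u n t i) \<longlonglongrightarrow> uh t i" for t i
    using LIMSEQ_subseq_LIMSEQ[OF v_lim[rule_format, of t i] s2] by (simp add: o_def u_def uh_def \<sigma>_eq)
  have u01: "0 \<le> u n t i" "u n t i \<le> 1" for n t i
    using est' by (auto simp: u_def)
  have uh01: "0 \<le> uh t i" "uh t i \<le> 1" for t i
    using LIMSEQ_le_const[OF u_lim, of 0] LIMSEQ_le_const2[OF u_lim, of _ _ 1] u01 by auto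
  have u_meas: "(\<lambda>t. u n t i) \<in> borel_measurable borel" for n i
    unfolding u_def by (rule measurable_step)
  have uh_meas: "(\<lambda>t. uh t i) \<in> borel_measurable borel" for i
    by (rule borel_measurable_LIMSEQ_metric[OF u_meas u_lim])
  have uh_cont: "continuous_on S (\<lambda>t. uh t i)" for S i
    using v_lip K by (intro lipschitz_on_continuous_on[of K] lipschitz_onI) (auto simp: uh_def dist_real_def)
  have b_meas: "(\<lambda>t. b n t i) \<in> borel_measurable borel" for n i
    unfolding b_def by (rule b0_meas)
  have g_meas: "(\<lambda>t. g t i) \<in> borel_measurable borel" for i
    using \<gamma>_meas by (simp add: g_def)
  have g_le: "\<bar>g t i\<bar> \<le> K" for t i
    using \<gamma>_le by (simp add: g_def)
  have b_le: "\<bar>b n t i\<bar> \<le> K" for n t i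
    unfolding b_def by (rule b0_le')
  have u1: "\<bar>u n t i\<bar> \<le> 1" "\<bar>uh t i\<bar> \<le> 1" for n t i
    using u01[of n t i] uh01[of t i] by (auto simp: abs_le_iff)
  have b_pos: "b n t i = B (\<sigma> n) (nat \<lceil>t / \<sigma> n\<rceil>) i" if "0 < t" for n t i
    using that by (simp add: b_def b0_def)
  have uh0: "uh 0 = u0"
  proof
    fix i
    have "u n 0 i = u0 i" for n
      using it(2)[of "s1 (s2 n)"] by (simp add: u_def \<sigma>_eq)
    then show "uh 0 i = u0 i"
      using u_lim[of 0 i] by (simp add: LIMSEQ_const_iff)
  qed

  \<comment> \<open>The residual of the discrete integral equation tends to 0 by
    \<open>error\<close> and, taking limits term by term, to the residual of the integrated flow
    equation; limits are unique.\<close>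
  have flow: "\<epsilon> * (uh t i - u0 i) = (LINT x|lborel. indicator {0<..t} x * ?R (uh x) (g x) i)"
    if t: "0 \<le> t" for t i
  proof -
    have error: "\<bar>\<epsilon> * u n t i - \<epsilon> * u0 i - (LINT x|lborel. indicator {0<..t} x * ?R (u n x) (b n x) i)\<bar>
        \<le> (K * (t + \<sigma> n) + H) * \<sigma> n" for n
    proof -
      have "\<bar>\<epsilon> * U (\<sigma> n) (nat \<lceil>t / \<sigma> n\<rceil>) i - \<epsilon> * U (\<sigma> n) 0 i
          - (LINT x|lborel. indicator {0<..t} x * ?R (U (\<sigma> n) (nat \<lceil>x / \<sigma> n\<rceil>)) (B (\<sigma> n) (nat \<lceil>x / \<sigma> n\<rceil>)) i)\<bar>
          \<le> (K * (t + \<sigma> n) + H) * \<sigma> n"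
      proof (rule step_integral_equation[of "\<sigma> n" t K "\<lambda>m. \<epsilon> * U (\<sigma> n) m i"
            "\<lambda>m. ?R (U (\<sigma> n) m) (B (\<sigma> n) m) i" H, OF \<sigma>(1) t K])
        fix m
        show "\<bar>\<epsilon> * U (\<sigma> n) (Suc m) i - \<epsilon> * U (\<sigma> n) m i
            - \<sigma> n * ?R (U (\<sigma> n) (Suc m)) (B (\<sigma> n) (Suc m)) i\<bar> \<le> K * (\<sigma> n)\<^sup>2"
          using est'(5)[of n m i] by (simp add: right_diff_distrib)
        show "\<bar>?R (U (\<sigma> n) (Suc m)) (B (\<sigma> n) (Suc m)) i\<bar> \<le> H"
          unfolding H_def using est'(1,2)[of n "Suc m"] est'(3)[of n m] \<epsilon>
          by (intro abs_flow_rhs_le) (auto simp: abs_le_iff intro: order_trans[of _ 0])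
      qed
      moreover have "indicator {0<..t} x * ?R (U (\<sigma> n) (nat \<lceil>x / \<sigma> n\<rceil>)) (B (\<sigma> n) (nat \<lceil>x / \<sigma> n\<rceil>)) i
          = indicator {0<..t} x * ?R (u n x) (b n x) i" for x
      proof (cases "0 < x")
        case True
        then have "u n x = U (\<sigma> n) (nat \<lceil>x / \<sigma> n\<rceil>)" "b n x = B (\<sigma> n) (nat \<lceil>x / \<sigma> n\<rceil>)"
          by (auto simp: u_def b_pos)
        then show ?thesis by simp
      qed simp
      ultimately show ?thesis
        using it(2)[of "s1 (s2 n)"] by (simp add: u_def \<sigma>_eq)
    qed
    have "(\<lambda>n. (K * (t + \<sigma> n) + H) * \<sigma> n) \<longlonglongrightarrow> (K * (t + 0) + H) * 0"
      by (intro tendsto_intros \<sigma>_lim)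
    then have error_lim: "(\<lambda>n. (K * (t + \<sigma> n) + H) * \<sigma> n) \<longlonglongrightarrow> 0"
      by simp
    have zero: "(\<lambda>n. \<epsilon> * u n t i - \<epsilon> * u0 i
        - (LINT x|lborel. indicator {0<..t} x * ?R (u n x) (b n x) i)) \<longlonglongrightarrow> 0"
      by (rule Lim_null_comparison[OF always_eventually error_lim]) (unfold real_norm_def, intro allI error)
    have ind: "integrable lborel (indicator {0<..t} :: real \<Rightarrow> real)"
      using t by simp
    have "(\<lambda>n. LINT x|lborel. indicator {0<..t} x * ?R (u n x) (\<lambda>_. 0) i)
        \<longlonglongrightarrow> (LINT x|lborel. indicator {0<..t} x * ?R (uh x) (\<lambda>_. 0) i)"
    proof (rule integral_dominated_convergence[where w = "\<lambda>x. H * indicator {0<..t} x"])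
      show "AE x in lborel. (\<lambda>n. indicator {0<..t} x * ?R (u n x) (\<lambda>_. 0) i)
          \<longlonglongrightarrow> indicator {0<..t} x * ?R (uh x) (\<lambda>_. 0) i"
        by (intro AE_I2 tendsto_intros tendsto_flow_rhs u_lim)
      have "\<bar>?R (u n x) (\<lambda>_. 0) i\<bar> \<le> H" for n x
        unfolding H_def using K \<epsilon> u1 by (intro abs_flow_rhs_le) auto
      then show "AE x in lborel. norm (indicator {0<..t} x * ?R (u n x) (\<lambda>_. 0) i) \<le> H * indicator {0<..t} x" for n
        by (auto simp: indicator_def)
      show "integrable lborel (\<lambda>x. H * indicator {0<..t} x)"
        using ind by simp
    qed (auto intro!: borel_measurable_times borel_measurable_flow_rhs u_meas uh_meas)
    moreover have b_lim: "(\<lambda>n. LINT x|lborel. b n x j * indicator {0<..t} x)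
        \<longlonglongrightarrow> (LINT x|lborel. g x j * indicator {0<..t} x)" for j
      unfolding b_def g_def by (rule weak'[OF ind])
    moreover have "(\<lambda>n. meanV \<omega> r (\<lambda>j. LINT x|lborel. b n x j * indicator {0<..t} x))
        \<longlonglongrightarrow> meanV \<omega> r (\<lambda>j. LINT x|lborel. g x j * indicator {0<..t} x)"
      unfolding meanV_eq_sum by (intro tendsto_intros b_lim)
    ultimately have "(\<lambda>n. LINT x|lborel. indicator {0<..t} x * ?R (u n x) (b n x) i)
        \<longlonglongrightarrow> (LINT x|lborel. indicator {0<..t} x * ?R (uh x) (g x) i)"
      unfolding integral_flow_rhs[of "u _" "b _", OF u_meas u1(1) b_meas b_le less_imp_le[OF \<epsilon>]]
        integral_flow_rhs[of uh g, OF uh_meas u1(2) g_meas g_le less_imp_le[OF \<epsilon>]]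
      by (intro tendsto_intros)
    then have "(\<lambda>n. \<epsilon> * u n t i - \<epsilon> * u0 i - (LINT x|lborel. indicator {0<..t} x * ?R (u n x) (b n x) i))
        \<longlonglongrightarrow> \<epsilon> * uh t i - \<epsilon> * u0 i - (LINT x|lborel. indicator {0<..t} x * ?R (uh x) (g x) i)"
      by (intro tendsto_intros u_lim)
    from LIMSEQ_unique[OF this zero] show ?thesis
      by (simp add: right_diff_distrib)
  qed

  \<comment> \<open>At t = 0 the cut-off terms b may differ from the obstacle values, so this null
    point is removed.\<close>
  have ae: "AE t in lborel. 0 \<le> t \<longrightarrow> 0 < t \<and> (\<forall>i. (\<lambda>k. (\<Sum>n<N k. b n t i) / real (N k)) \<longlonglongrightarrow> g t i)"
    using means' AE_lborel_singleton[of "0::real"]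
    by eventually_elim (auto simp: b_def g_def)

  have "AC_solution \<omega> r \<epsilon> uh g"
    unfolding AC_solution_def
  \<comment> \<open>With this choice of derivative the flow equation is an algebraic identity. The
    content is that it is the weak derivative, which rests on \<open>flow\<close>, and that g
    satisfies the sign conditions.\<close>
  proof (intro exI[of _ "\<lambda>t i. ?R (uh t) (g t) i / \<epsilon>"] conjI allI impI)
    fix a b' :: real and i assume ab: "0 \<le> a \<and> a < b'"
    have R: "\<bar>?R (uh t) (g t) i / \<epsilon>\<bar> \<le> H / \<epsilon>" for t
      unfolding abs_divide H_def using \<epsilon> u1 g_le by (auto intro!: divide_right_mono abs_flow_rhs_le)
    show "H1_with_deriv a b' (\<lambda>t. uh t i) (\<lambda>t. ?R (uh t) (g t) i / \<epsilon>)"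
    proof (rule H1_with_deriv_integral[where C = "max 1 (H / \<epsilon>)" and ?f0.0 = "u0 i"])
      show "(\<lambda>t. ?R (uh t) (g t) i / \<epsilon>) \<in> borel_measurable borel"
        by (intro borel_measurable_divide borel_measurable_flow_rhs uh_meas g_meas) auto
      show "uh t i = u0 i + (LINT x|lborel. indicator {0<..t} x * (?R (uh x) (g x) i / \<epsilon>))" if "0 \<le> t" for t
        using flow[OF that, of i] \<epsilon> by (simp add: field_simps)
    qed (use ab u1 R uh_meas in \<open>auto simp: le_max_iff_disj\<close>)
  next
    show "AE t in lborel. 0 \<le> t \<longrightarrow>
      (\<forall>i. \<epsilon> * (?R (uh t) (g t) i / \<epsilon>) + \<epsilon> * lap \<omega> r (uh t) i - uh t i + meanV \<omega> r (uh t)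
         = g t i - meanV \<omega> r (g t)) \<and> inB (uh t) (g t)"
      using ae
    proof (eventually_elim, intro impI conjI allI)
      fix t :: real assume t: "0 \<le> t"
        and *: "0 \<le> t \<longrightarrow> 0 < t \<and> (\<forall>i. (\<lambda>k. (\<Sum>n<N k. b n t i) / real (N k)) \<longlonglongrightarrow> g t i)"
      show "\<epsilon> * (?R (uh t) (g t) i / \<epsilon>) + \<epsilon> * lap \<omega> r (uh t) i - uh t i + meanV \<omega> r (uh t)
         = g t i - meanV \<omega> r (g t)" for i
        using \<epsilon> by (simp add: flow_rhs_def)
      from t * have t_pos: "0 < t" and mean: "\<And>i. (\<lambda>k. (\<Sum>n<N k. b n t i) / real (N k)) \<longlonglongrightarrow> g t i"
        by auto
      have B: "inB (u n t) (b n t)" for n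
      proof -
        have "0 < \<lceil>t / \<sigma> n\<rceil>" using t_pos \<sigma>[of n] by simp
        then obtain m where m: "nat \<lceil>t / \<sigma> n\<rceil> = Suc m"
          by (metis gr0_conv_Suc zero_less_nat_eq)
        have "inB (U (\<sigma> n) (Suc m)) (B (\<sigma> n) (Suc m))"
          using it(1)[of "s1 (s2 n)"] by (simp add: semi_iter_def \<sigma>_eq)
        moreover have "u n t = U (\<sigma> n) (Suc m)" "b n t = B (\<sigma> n) (Suc m)"
          using t_pos m by (auto simp: u_def b_pos)
        ultimately show ?thesis by simp
      qed
      \<comment> \<open>Where the limit is positive, the iterates are positive from some n on, which
        forces b \<le> 0. Strictly between the obstacles, \<open>neg\<close> and \<open>pos\<close>
        together give 0.\<close>
      have neg: "g t i \<le> 0" if "0 < uh t i" for i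
      proof (rule means_limit_nonpos[OF _ N mean])
        show "\<forall>\<^sub>F n in sequentially. b n t i \<le> 0"
          using order_tendstoD(1)[OF u_lim that]
        proof eventually_elim
          case (elim n)
          then show ?case
            using B[of n] u01(2)[of n t i] by (auto simp: inB_def less_le dest!: spec[of _ i])
        qed
      qed
      have pos: "0 \<le> g t i" if "uh t i < 1" for i
      proof (rule means_limit_nonneg[OF _ N mean])
        show "\<forall>\<^sub>F n in sequentially. 0 \<le> b n t i"
          using order_tendstoD(2)[OF u_lim that]
        proof eventually_elim
          case (elim n)
          then show ?case
            using B[of n] u01(1)[of n t i] by (auto simp: inB_def less_le dest!: spec[of _ i])
        qed
      qed
      show "inB (uh t) (g t)"
        unfolding inB_def using uh01 neg pos by (auto intro: antisym)
    qed
  qed (use uh01 uh_cont in auto)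
  \<comment> \<open>Testing with L1 covers both modes of convergence, since L2 functions on a
    bounded interval are integrable.\<close>
  moreover have test: "(\<lambda>n. LINT t|lebesgue_on {0..T}. ipV \<omega> r (B (\<tau> (s n)) (nat \<lceil>t / \<tau> (s n)\<rceil>)) (\<phi> t))
        \<longlonglongrightarrow> (LINT t|lebesgue_on {0..T}. ipV \<omega> r (g t) (\<phi> t))"
    if \<phi>: "\<forall>i. L1_on {0..T} (\<lambda>t. \<phi> t i)" for T \<phi>
  proof -
    define P where "P i h \<longleftrightarrow> integrable lborel h \<and> (\<forall>t\<le>0. h t = 0) \<and>
      (\<forall>f C. f \<in> borel_measurable borel \<and> (\<forall>t. \<bar>f t\<bar> \<le> C) \<longrightarrow>
         integrable (lebesgue_on {0..T}) (\<lambda>t. f t * \<phi> t i) \<and>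
         (LINT t|lebesgue_on {0..T}. f t * \<phi> t i) = (LINT t|lborel. f t * h t))" for i h
    have "\<exists>h. P i h" for i
      unfolding P_def by (rule L1_on_test_function) (use \<phi> in simp)
    then obtain h where P: "\<And>i. P i (h i)"
      by metis
    have h: "integrable lborel (h i)" "t \<le> 0 \<Longrightarrow> h i t = 0" for i t
      using P[of i] by (auto simp: P_def)
    have ip: "(LINT t|lebesgue_on {0..T}. ipV \<omega> r (f t) (\<phi> t)) = (\<Sum>i\<in>UNIV. (LINT t|lborel. f t i * h i t) * dpow \<omega> r i)"
      if f: "\<And>i. (\<lambda>t. f t i) \<in> borel_measurable borel" "\<And>i. \<exists>C. \<forall>t. \<bar>f t i\<bar> \<le> C" for f :: "real \<Rightarrow> 'v \<Rightarrow> real"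
    proof -
      have i: "integrable (lebesgue_on {0..T}) (\<lambda>t. f t i * \<phi> t i)"
        and e: "(LINT t|lebesgue_on {0..T}. f t i * \<phi> t i) = (LINT t|lborel. f t i * h i t)" for i
        using f[of i] P[of i] by (auto simp: P_def)
      show ?thesis
        unfolding ipV_def e[symmetric] using i by simp
    qed
    have "(LINT t|lebesgue_on {0..T}. ipV \<omega> r (B (\<tau> (s n)) (nat \<lceil>t / \<tau> (s n)\<rceil>)) (\<phi> t))
        = (\<Sum>i\<in>UNIV. (LINT t|lborel. b0 (\<sigma> n) i t * h i t) * dpow \<omega> r i)" for n
    proof -
      have "\<exists>C. \<forall>t::real. \<bar>B (\<sigma> n) (nat \<lceil>t / \<sigma> n\<rceil>) i\<bar> \<le> C" for i
      proof (intro exI allI)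
        fix t :: real
        \<comment> \<open>Index 0 brings in the unconstrained value of B. The bound may depend on n,
          as it only serves integrability.\<close>
        show "\<bar>B (\<sigma> n) (nat \<lceil>t / \<sigma> n\<rceil>) i\<bar> \<le> max K \<bar>B (\<sigma> n) 0 i\<bar>"
          using est'(3)[of n _ i] by (cases "nat \<lceil>t / \<sigma> n\<rceil>") (auto simp: le_max_iff_disj)
      qed
      then have "(LINT t|lebesgue_on {0..T}. ipV \<omega> r (B (\<sigma> n) (nat \<lceil>t / \<sigma> n\<rceil>)) (\<phi> t))
          = (\<Sum>i\<in>UNIV. (LINT t|lborel. B (\<sigma> n) (nat \<lceil>t / \<sigma> n\<rceil>) i * h i t) * dpow \<omega> r i)"
        by (intro ip measurable_step)
      moreover have "B (\<sigma> n) (nat \<lceil>t / \<sigma> n\<rceil>) i * h i t = b0 (\<sigma> n) i t * h i t" for i t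
        using h(2)[of t i] by (cases "0 < t") (auto simp: b0_def)
      ultimately show ?thesis
        unfolding \<sigma>_def by (simp only:)
    qed
    moreover have "(LINT t|lebesgue_on {0..T}. ipV \<omega> r (g t) (\<phi> t))
        = (\<Sum>i\<in>UNIV. (LINT t|lborel. \<gamma> i t * h i t) * dpow \<omega> r i)"
      using ip[of g] g_meas g_le by (auto simp: g_def)
    moreover have "(\<lambda>n. \<Sum>i\<in>UNIV. (LINT t|lborel. b0 (\<sigma> n) i t * h i t) * dpow \<omega> r i)
        \<longlonglongrightarrow> (\<Sum>i\<in>UNIV. (LINT t|lborel. \<gamma> i t * h i t) * dpow \<omega> r i)"
      by (intro tendsto_intros weak' h(1))
    ultimately show ?thesis
      by simp
  qed
  moreover have "weak_L2loc \<omega> r (\<lambda>n t. B (\<tau> (s n)) (nat \<lceil>t / \<tau> (s n)\<rceil>)) g"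
    unfolding weak_L2loc_def
  proof (intro allI impI conjI)
    show "L2_on {0..T} (\<lambda>t. g t i)" for T i
      by (rule bounded_imp_L2_on[OF _ g_meas g_le]) simp
  qed (intro test allI, rule L2_on_imp_L1_on, auto)
  moreover have "weakstar_Linfloc \<omega> r (\<lambda>n t. B (\<tau> (s n)) (nat \<lceil>t / \<tau> (s n)\<rceil>)) g"
    unfolding weakstar_Linfloc_def
  proof (intro allI impI conjI)
    show "Linf_on {0..T} (\<lambda>t. g t i)" for T i
      by (rule bounded_imp_Linf_on[OF g_meas g_le])
  qed (intro test allI, auto)
  moreover have "AE t in lborel. 0 \<le> t \<longrightarrow>
     (\<forall>i. (\<lambda>k. (1 / real (N k)) * (\<Sum>n<N k. B (\<tau> (s n)) (nat \<lceil>t / \<tau> (s n)\<rceil>) i)) \<longlonglongrightarrow> g t i)"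
    using ae by eventually_elim (auto simp: b_pos \<sigma>_def)
  ultimately show ?thesis
    using s \<sigma>(2) uh0 u_lim N
    by (intro exI[of _ s] exI[of _ uh] exI[of _ g] exI[of _ N] conjI)
      (auto simp: \<sigma>_def u_def intro: filterlim_subseq)
qed

end
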